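(* Let $d\ge 2$, $k>d$ and $s\in(0,d)$ with $$s<d-\frac{\binom d2}{k}.$$ Then: (a) there exist a connected graph $G_{k+1,m}$ that is minimally infinitesimally rigid in $\mathbb R^d$ and a compact set $E\subset\mathbb R^d$ of Hausdorff dimension $s$ such that $\mathcal L^m(\Delta(G_{k+1,m},E^{k+1}))=0$; (b) there exist a graph $G_{k+1,m}$ without isolated vertices, a maximally independent (in $\mathbb R^d$) subset $H$ of edges of $G_{k+1,m}$, and a compact set $E\subset\mathbb R^d$ of Hausdorff dimension $s$ such that it is not the case that both $\dim\Delta(G_{k+1,m},E^{k+1})=|H|$ and $\mathcal H^{|H|}(\Delta(G_{k+1,m},E^{k+1}))>0$.
   Context: $\dim$ is Hausdorff dimension, $\mathcal H^s$ is $s$-dimensional Hausdorff measure and $\mathcal L^m$ is Lebesgue measure on $\mathbb R^m$. $K_{k+1}$ is the complete graph on the vertex set $\{1,\dots,k+1\}$, with edge set ordered lexicographically. $G_{k+1,m}$ denotes a subgraph of $K_{k+1}$ with all $k+1$ vertices and $m$ edges, inheriting the edge order; $ij\in G_{k+1,m}$ means $i<j$ and $\{i,j\}$ is an edge. A $(k+1)$-tuple in $\mathbb R^d$ is $\mathbf x=(x^1,\dots,x^{k+1})\in\mathbb R^{d(k+1)}$ with $x^j\in\mathbb R^d$. For a graph $G$ on these vertices, $f_G(\mathbf x)=(|x^i-x^j|)_{ij\in G}$ and $F_G(\mathbf x)=(|x^i-x^j|^2)_{ij\in G}$, with $|\cdot|$ the Euclidean norm. For $\mathfrak X\subseteq\mathbb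 R^{d(k+1)}$, $\Delta(G,\mathfrak X)=f_G(\mathfrak X)$. $DF_G(\mathbf x)$ is the total derivative (Jacobian matrix) of $F_G$, whose rows are indexed by the edges of $G$. A set $H$ of edges of $K_{k+1}$ is independent in $\mathbb R^d$ with respect to $\mathbf x_0$ if the rows of $DF_{K_{k+1}}(\mathbf x_0)$ corresponding to $H$ are linearly independent; $H$ is independent in $\mathbb R^d$ if this holds for some $\mathbf x_0\in\mathbb R^{d(k+1)}$. A maximally independent (in $\mathbb R^d$) subset of edges of $G$ is a set of edges of $G$ that is independent in $\mathbb R^d$ and is not contained in a larger independent set of edges of $G$. For a nonempty independent $H$, $P_H(\mathbf x)$ is the sum of the squares of all $|H|\times|H|$ minors of the submatrix of $DF_{K_{k+1}}(\mathbf x)$ formed by the rows in $H$, and $X_H$ is its zero set. A tuple is generic if it lies outside $X$, where $X$ is the zero set of $P=\prod_{H\text{ independent}}P_H$ (so $X=\bigcup_H X_H$). A framework $(G,\mathbf x)$ is infinitesimally rigid in $\mathbb R^d$ if $\ker DF_G(\mathbf x)=\ker DF_{K_{k+1}}(\mathbf x)$. A graph $G$ is infinitesimally rigid in $\mathbb R^d$ if $(G,\mathbf x)$ is infinitesimally rigid for every generic tuple $\mathbf x$; it is minimally infinitesimally rigid if moreover no proper subgraph on the same vertex set is infinitesimally rigid. *)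

theory Defs
  imports "Jordan_Normal_Form.Determinant" "HOL-Analysis.Analysis"
begin

no_notation vec_index (infixl "$" 100)

section \<open>Hausdorff measure and dimension\<close>

text \<open>
  The term \<open>|U|\<^sup>s\<close> of a cover. The conventions are \<open>|{}|\<^sup>s = 0\<close> and \<open>|U|\<^sup>0 = 1\<close> for nonempty \<open>U\<close>;
  the latter has to be stated because \<open>0 powr 0 = 0\<close> in the library.
\<close>

definition diameter_powr :: "real \<Rightarrow> 'a::metric_space set \<Rightarrow> ennreal" where
  "diameter_powr s U =
     (if U = {} then 0 else if s = 0 then 1 else ennreal (diameter U powr s))"

text \<open>Boundedness is required explicitly: \<^const>\<open>diameter\<close> is unspecified on unbounded sets.\<close>

definition hausdorff_premeasure :: "real \<Rightarrow> real \<Rightarrow> 'a::metric_space set \<Rightarrow> ennreal" where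
  "hausdorff_premeasure s \<delta> A =
     (INF U \<in> {U :: nat \<Rightarrow> 'a set. A \<subseteq> (\<Union>i. U i) \<and> (\<forall>i. bounded (U i) \<and> diameter (U i) \<le> \<delta>)}.
        (\<Sum>i. diameter_powr s (U i)))"

definition hausdorff_measure :: "real \<Rightarrow> 'a::metric_space set \<Rightarrow> ennreal" where
  "hausdorff_measure s A = (SUP \<delta> \<in> {0<..}. hausdorff_premeasure s \<delta> A)"

definition hausdorff_dim :: "'a::metric_space set \<Rightarrow> ereal" where
  "hausdorff_dim A = Inf {ereal s | s. 0 \<le> s \<and> hausdorff_measure s A = 0}"

section \<open>Graphs\<close>

text \<open>
  The vertices are the elements of a finite linearly ordered type \<open>'v\<close>, standing for
  \<open>{1, \<dots>, k + 1}\<close> when \<open>CARD('v) = k + 1\<close>. A graph on all the vertices is given by its edge set,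
  the edge \<open>{i, j}\<close> with \<open>i < j\<close> being the pair \<open>(i, j)\<close>.
\<close>

definition complete_graph :: "('v::{finite,linorder} \<times> 'v) set" where
  "complete_graph = {(i, j). i < j}"

definition graph_connected :: "('v \<times> 'v) set \<Rightarrow> bool" where
  "graph_connected G \<longleftrightarrow> (\<forall>u v. (u, v) \<in> (G \<union> G\<inverse>)\<^sup>*)"

definition no_isolated_vertices :: "('v \<times> 'v) set \<Rightarrow> bool" where
  "no_isolated_vertices G \<longleftrightarrow> (\<forall>v. \<exists>w. (v, w) \<in> G \<or> (w, v) \<in> G)"

section \<open>Tuples, distance maps and distance sets\<close>

text \<open>
  A tuple of points of \<open>real ^ 'd\<close>, one for each vertex, is a single vector whose coordinates are
  indexed by pairs of a vertex and a coordinate of \<open>real ^ 'd\<close>.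
\<close>

definition point :: "real ^ ('v::finite \<times> 'd) \<Rightarrow> 'v \<Rightarrow> real ^ 'd::finite" where
  "point x i = (\<chi> c. x $ (i, c))"

definition tuples_in :: "(real ^ 'd::finite) set \<Rightarrow> (real ^ ('v::finite \<times> 'd)) set" where
  "tuples_in E = {x. \<forall>i. point x i \<in> E}"

text \<open>
  The number \<open>m\<close> of edges depends on the graph. The maps \<open>f\<^sub>G\<close> and \<open>F\<^sub>G\<close> therefore take their values
  in the coordinate subspace of \<open>real ^ ('v \<times> 'v)\<close> of the vectors vanishing outside \<open>G\<close>, an
  isometric copy of \<open>\<real>\<^sup>m\<close>.
\<close>

definition dist_map ::
  "('v \<times> 'v) set \<Rightarrow> real ^ ('v::{finite,linorder} \<times> 'd::finite) \<Rightarrow> real ^ ('v \<times> 'v)" where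
  "dist_map G x = (\<chi> e. if e \<in> G then norm (point x (fst e) - point x (snd e)) else 0)"

definition sqdist_map ::
  "('v \<times> 'v) set \<Rightarrow> real ^ ('v::{finite,linorder} \<times> 'd::finite) \<Rightarrow> real ^ ('v \<times> 'v)" where
  "sqdist_map G x = (\<chi> e. if e \<in> G then (norm (point x (fst e) - point x (snd e)))\<^sup>2 else 0)"

definition distance_set ::
  "('v \<times> 'v) set \<Rightarrow> (real ^ ('v::{finite,linorder} \<times> 'd::finite)) set \<Rightarrow> (real ^ ('v \<times> 'v)) set" where
  "distance_set G X = dist_map G ` X"

text \<open>
  Lebesgue measure on \<open>\<real>\<^sup>m\<close>, with coordinates indexed by the \<open>m\<close> edges of \<open>G\<close>. As this lives on the
  function space \<open>\<real>\<^sup>G\<close>, a subset of the coordinate subspace above is transported to it by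
  restricting the coordinates to \<open>G\<close>.
\<close>

definition lebesgue_edges :: "('v \<times> 'v) set \<Rightarrow> ('v \<times> 'v \<Rightarrow> real) measure" where
  "lebesgue_edges G = completion (Pi\<^sub>M G (\<lambda>_. lborel))"

definition edge_coords :: "('v \<times> 'v) set \<Rightarrow> real ^ ('v::finite \<times> 'v) \<Rightarrow> 'v \<times> 'v \<Rightarrow> real" where
  "edge_coords G y = (\<lambda>e\<in>G. y $ e)"

section \<open>Independence and genericity\<close>

definition DF ::
  "('v \<times> 'v) set \<Rightarrow> real ^ ('v \<times> 'd) \<Rightarrow> real ^ ('v::{finite,linorder} \<times> 'd::finite) ^ ('v \<times> 'v)" where
  "DF G x = jacobian (sqdist_map G) (at x)"

definition independent_at ::
  "('v \<times> 'v) set \<Rightarrow> real ^ ('v::{finite,linorder} \<times> 'd::finite) \<Rightarrow> bool" where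
  "independent_at H x \<longleftrightarrow> H \<subseteq> complete_graph \<and>
     inj_on (\<lambda>e. row e (DF complete_graph x)) H \<and>
     independent ((\<lambda>e. row e (DF complete_graph x)) ` H)"

definition independent_edges :: "'d::finite itself \<Rightarrow> ('v::{finite,linorder} \<times> 'v) set \<Rightarrow> bool" where
  "independent_edges _ H \<longleftrightarrow> (\<exists>x :: real ^ ('v \<times> 'd). independent_at H x)"

definition maximally_independent ::
  "'d::finite itself \<Rightarrow> ('v::{finite,linorder} \<times> 'v) set \<Rightarrow> ('v \<times> 'v) set \<Rightarrow> bool" where
  "maximally_independent T G H \<longleftrightarrow> H \<subseteq> G \<and> independent_edges T H \<and>
     \<not> (\<exists>H'. H \<subset> H' \<and> H' \<subseteq> G \<and> independent_edges T H')"

text \<open>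
  The \<open>H \<times> C\<close> minor of a matrix, for \<open>card H = card C\<close>. The rows and columns are enumerated by
  \<^const>\<open>from_nat_into\<close>; this affects at most the sign of the minor, and only its square is used.
\<close>

definition minor :: "real ^ 'n::finite ^ 'm::finite \<Rightarrow> 'm set \<Rightarrow> 'n set \<Rightarrow> real" where
  "minor M H C = Determinant.det
     (Matrix.mat (card H) (card C) (\<lambda>(a, b). M $ from_nat_into H a $ from_nat_into C b))"

definition P_edges :: "('v \<times> 'v) set \<Rightarrow> real ^ ('v::{finite,linorder} \<times> 'd::finite) \<Rightarrow> real" where
  "P_edges H x = (\<Sum>C | card C = card H. (minor (DF complete_graph x) H C)\<^sup>2)"

definition P_total :: "real ^ ('v::{finite,linorder} \<times> 'd::finite) \<Rightarrow> real" where
  "P_total x = (\<Prod>H | H \<noteq> {} \<and> independent_edges TYPE('d) H. P_edges H x)"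

definition generic :: "real ^ ('v::{finite,linorder} \<times> 'd::finite) \<Rightarrow> bool" where
  "generic x \<longleftrightarrow> P_total x \<noteq> 0"

section \<open>Infinitesimal rigidity\<close>

definition framework_inf_rigid ::
  "('v \<times> 'v) set \<Rightarrow> real ^ ('v::{finite,linorder} \<times> 'd::finite) \<Rightarrow> bool" where
  "framework_inf_rigid G x \<longleftrightarrow> {v. DF G x *v v = 0} = {v. DF complete_graph x *v v = 0}"

definition inf_rigid :: "'d::finite itself \<Rightarrow> ('v::{finite,linorder} \<times> 'v) set \<Rightarrow> bool" where
  "inf_rigid _ G \<longleftrightarrow> (\<forall>x :: real ^ ('v \<times> 'd). generic x \<longrightarrow> framework_inf_rigid G x)"

definition minimally_inf_rigid :: "'d::finite itself \<Rightarrow> ('v::{finite,linorder} \<times> 'v) set \<Rightarrow> bool" where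
  "minimally_inf_rigid T G \<longleftrightarrow> inf_rigid T G \<and> (\<forall>G'. G' \<subset> G \<longrightarrow> \<not> inf_rigid T G')"

end

theory Submission
  imports Defs
begin

text \<open>
  Let \<open>E\<close> be the set of points all of whose coordinates have the form \<open>\<Sum>j. a\<^sub>j r\<^sup>j\<close> with digits
  \<open>a\<^sub>j \<in> {0, \<dots>, M - 1}\<close>, where \<open>M r\<^sup>s\<^sup>/\<^sup>d = 1\<close>. This set is self-similar of dimension \<open>s\<close>, and its
  differences have digits in a set of at most \<open>2 M\<close> elements. Distances between points of a \<open>(k + 1)\<close>-tuple
  only depend on the \<open>k\<close> differences to a base point, so every distance set of \<open>E\<close> is covered by
  \<open>(2 M)\<^sup>d\<^sup>k\<^sup>n\<close> cubes of side about \<open>r\<^sup>n\<close>; in dimension \<open>m\<close> their total volume tends to \<open>0\<close> as soon as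
  \<open>(2 M)\<^sup>d\<^sup>k r\<^sup>m < 1\<close>. For \<open>m = d k - (d choose 2)\<close> and \<open>M\<close> large this is the hypothesis on \<open>s\<close>.

  A graph with exactly \<open>m\<close> edges that is independent in \<open>\<real>\<^sup>d\<close> consists of all edges meeting a fixed set of
  \<open>d\<close> vertices. It settles (b). An infinitesimally rigid graph has at least as many edges as any
  independent one, so any minimal infinitesimally rigid graph settles (a).
\<close>

no_notation Matrix.scalar_prod (infix \<open>\<bullet>\<close> 70)

section \<open>Sets of digit expansions\<close>

definition digit_value :: "real \<Rightarrow> (nat \<Rightarrow> real) \<Rightarrow> real" where
  "digit_value r a = (\<Sum>j. a j * r ^ j)"

definition digit_set :: "real set \<Rightarrow> real \<Rightarrow> real set" where
  "digit_set A r = digit_value r ` {a. \<forall>j. a j \<in> A}"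

text \<open>The digits form an arbitrary finite set of reals, because the same facts are applied to
  the digits \<open>{0, ..., M - 1}\<close> of the fractal and to the possibly negative digits of
  its differences.\<close>

locale digit_system =
  fixes A :: "real set" and r :: real
  assumes finite_digits: "finite A" and ratio_pos: "0 < r" and ratio_less_1: "r < 1"
begin

lemma summable_digits:
  assumes "\<And>j. a j \<in> A"
  shows "summable (\<lambda>j. a j * r ^ j)"
proof -
  obtain B where B: "\<And>x. x \<in> A \<Longrightarrow> norm x \<le> B"
    using finite_imp_bounded[OF finite_digits] by (auto simp: bounded_iff)
  have "summable (\<lambda>j. B * r ^ j)"
    using ratio_pos ratio_less_1 by (intro summable_mult summable_geometric) auto
  then show ?thesis
    by (rule summable_comparison_test'[where N = 0])
       (use ratio_pos B assms in \<open>auto simp: abs_mult intro!: mult_right_mono\<close>)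
qed

lemma digit_value_split:
  assumes "\<And>j. a j \<in> A"
  shows "digit_value r a = a 0 + r * digit_value r (\<lambda>j. a (Suc j))"
proof -
  have "digit_value r a = a 0 + (\<Sum>j. a (Suc j) * r ^ Suc j)"
    using suminf_split_head[OF summable_digits[of a]] assms by (simp add: digit_value_def)
  also have "(\<Sum>j. a (Suc j) * r ^ Suc j) = r * (\<Sum>j. a (Suc j) * r ^ j)"
    using suminf_mult[OF summable_digits[of "\<lambda>j. a (Suc j)"], of r] assms by (simp add: mult_ac)
  finally show ?thesis by (simp add: digit_value_def)
qed

lemma digit_setE:
  assumes "p \<in> digit_set A r"
  obtains x q where "x \<in> A" "q \<in> digit_set A r" "p = x + r * q"
proof -
  obtain a where a: "\<And>j. a j \<in> A" and p: "p = digit_value r a"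
    using assms unfolding digit_set_def by blast
  show ?thesis
    by (rule that[of "a 0" "digit_value r (\<lambda>j. a (Suc j))"])
       (use a digit_value_split[of a] p in \<open>auto simp: digit_set_def\<close>)
qed

text \<open>Iterating \<open>step\<close> peels off one digit after another; the remainder is
  \<open>r ^ n\<close> times a point of the bounded set \<open>S\<close> and tends to 0. This is how
  closedness of a digit set and the existence of expansions to base \<open>1 / M\<close> are
  obtained.\<close>

lemma subset_digit_set:
  assumes "bounded S" and step: "\<And>x. x \<in> S \<Longrightarrow> \<exists>a\<in>A. \<exists>y\<in>S. x = a + r * y"
  shows "S \<subseteq> digit_set A r"
proof
  fix x assume x: "x \<in> S"
  obtain f g where fg: "\<And>x. x \<in> S \<Longrightarrow> f x \<in> A \<and> g x \<in> S \<and> x = f x + r * g x"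
    using step by metis
  define y where "y n = (g ^^ n) x" for n
  have y: "y n \<in> S" for n
    by (induction n) (auto simp: y_def x fg)
  have partial: "x = (\<Sum>j<n. f (y j) * r ^ j) + r ^ n * y n" for n
  proof (induction n)
    case (Suc n)
    have "y n = f (y n) + r * y (Suc n)" using fg[OF y] by (simp add: y_def)
    then have "r ^ n * y n = r ^ n * (f (y n) + r * y (Suc n))" by simp
    then have "r ^ n * y n = f (y n) * r ^ n + r ^ Suc n * y (Suc n)"
      by (simp add: algebra_simps)
    then show ?case using Suc by simp
  qed (simp add: y_def)
  have A: "f (y j) \<in> A" for j using fg[OF y] by blast
  obtain B where "\<And>z. z \<in> S \<Longrightarrow> norm z \<le> B"
    using \<open>bounded S\<close> by (auto simp: bounded_iff)
  then have "Bseq y" using y by (intro BseqI') blast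
  moreover have "(\<lambda>n. r ^ n) \<longlonglongrightarrow> 0"
    using ratio_pos ratio_less_1 by (intro LIMSEQ_power_zero) auto
  ultimately have "(\<lambda>n. r ^ n * y n) \<longlonglongrightarrow> 0"
    using bounded_bilinear.Zfun_prod_Bfun[OF bounded_bilinear_mult] by (auto simp: tendsto_Zfun_iff)
  then have "(\<lambda>n. x - r ^ n * y n) \<longlonglongrightarrow> x - 0" by (intro tendsto_intros)
  moreover have "x - r ^ n * y n = (\<Sum>j<n. f (y j) * r ^ j)" for n
    using partial[of n] by linarith
  ultimately have "(\<lambda>j. f (y j) * r ^ j) sums x"
    by (simp add: sums_def)
  then have "x = digit_value r (\<lambda>j. f (y j))"
    by (simp add: digit_value_def sums_iff)
  then show "x \<in> digit_set A r"
    using A by (auto simp: digit_set_def)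
qed

lemma bounded_digit_set: "bounded (digit_set A r)"
proof -
  obtain B where B: "\<And>x. x \<in> A \<Longrightarrow> norm x \<le> B"
    using finite_imp_bounded[OF finite_digits] by (auto simp: bounded_iff)
  have "norm p \<le> (\<Sum>j. B * r ^ j)" if "p \<in> digit_set A r" for p
  proof -
    obtain a where a: "\<And>j. a j \<in> A" and p: "p = digit_value r a"
      using \<open>p \<in> digit_set A r\<close> unfolding digit_set_def by blast
    have "summable (\<lambda>j. B * r ^ j)"
      using ratio_pos ratio_less_1 by (intro summable_mult summable_geometric) auto
    then show ?thesis
      unfolding p digit_value_def using ratio_pos
      by (intro norm_suminf_le) (use B a in \<open>auto simp: abs_mult intro!: mult_right_mono\<close>)
  qed
  then show ?thesis by (auto simp: bounded_iff)
qed

text \<open>The closure inherits the self-similarity: the finite union of its scaled translates is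
  compact, hence closed, and contains the digit set, so it contains the closure. Every point of the
  closure therefore splits off a digit, and \<open>subset_digit_set\<close> returns it to the digit
  set.\<close>

lemma compact_digit_set: "compact (digit_set A r)"
proof -
  let ?C = "closure (digit_set A r)"
  let ?U = "\<Union>x\<in>A. (\<lambda>y. x + r * y) ` ?C"
  have C: "compact ?C" using bounded_digit_set by simp
  then have "compact ?U"
    using finite_digits by (intro compact_UN compact_continuous_image continuous_intros) auto
  then have "closed ?U" by (rule compact_imp_closed)
  moreover have "digit_set A r \<subseteq> ?U"
  proof
    fix p assume "p \<in> digit_set A r"
    then obtain x q where "x \<in> A" "q \<in> digit_set A r" "p = x + r * q" by (rule digit_setE)
    then show "p \<in> ?U" using closure_subset[of "digit_set A r"] by blast
  qed
  ultimately have "?C \<subseteq> ?U" by (rule closure_minimal[rotated])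
  then have "?C \<subseteq> digit_set A r"
    using compact_imp_bounded[OF C] by (intro subset_digit_set) blast+
  then have eq: "?C = digit_set A r" using closure_subset by blast
  from C[unfolded eq] show ?thesis .
qed

text \<open>The first \<open>n\<close> digits determine a point up to \<open>r ^ n\<close> times a
  point of the same bounded set. \<open>B\<close> bounds that set and is independent of
  \<open>n\<close>, so only the count and the ratio matter in the limit.\<close>

lemma digit_set_cover:
  "\<exists>B\<ge>0. \<forall>n. \<exists>F. finite F \<and> card F \<le> card A ^ n \<and> (\<forall>p\<in>digit_set A r. \<exists>y\<in>F. \<bar>p - y\<bar> \<le> B * r ^ n)"
proof -
  obtain B where "B > 0" and B: "\<And>p. p \<in> digit_set A r \<Longrightarrow> \<bar>p\<bar> \<le> B"
    using bounded_digit_set by (auto simp: bounded_pos)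
  have "\<exists>F. finite F \<and> card F \<le> card A ^ n \<and> (\<forall>p\<in>digit_set A r. \<exists>y\<in>F. \<bar>p - y\<bar> \<le> B * r ^ n)" for n
  proof (induction n)
    case 0
    then show ?case using B by (intro exI[of _ "{0}"]) auto
  next
    case (Suc n)
    then obtain F where F: "finite F" "card F \<le> card A ^ n"
      "\<And>p. p \<in> digit_set A r \<Longrightarrow> \<exists>y\<in>F. \<bar>p - y\<bar> \<le> B * r ^ n" by blast
    let ?F = "(\<lambda>(x, y). x + r * y) ` (A \<times> F)"
    have "card ?F \<le> card A * card F"
      using card_image_le[of "A \<times> F"] F(1) finite_digits by (simp add: card_cartesian_product)
    also have "\<dots> \<le> card A ^ Suc n" using F(2) by simp
    finally have "card ?F \<le> card A ^ Suc n" .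
    moreover have "\<exists>y\<in>?F. \<bar>p - y\<bar> \<le> B * r ^ Suc n" if "p \<in> digit_set A r" for p
    proof -
      obtain x q where xq: "x \<in> A" "q \<in> digit_set A r" "p = x + r * q" using \<open>p \<in> digit_set A r\<close> by (rule digit_setE)
      obtain y where y: "y \<in> F" "\<bar>q - y\<bar> \<le> B * r ^ n" using F(3) xq(2) by blast
      have "p - (x + r * y) = r * (q - y)" by (simp add: xq algebra_simps)
      then have "\<bar>p - (x + r * y)\<bar> = r * \<bar>q - y\<bar>" using ratio_pos by (simp add: abs_mult)
      also have "\<dots> \<le> r * (B * r ^ n)" using y(2) ratio_pos by (intro mult_left_mono) auto
      finally have "\<bar>p - (x + r * y)\<bar> \<le> B * r ^ Suc n" by (simp add: mult_ac)
      moreover have "x + r * y \<in> ?F" using xq y by force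
      ultimately show ?thesis by blast
    qed
    ultimately show ?case using F(1) finite_digits by (intro exI[of _ ?F]) auto
  qed
  then show ?thesis using \<open>B > 0\<close> by (intro exI[of _ B] conjI allI) simp_all
qed

end

text \<open>Subtraction is performed digit by digit without carries, at the price of the larger
  digit set \<open>A'\<close>.\<close>

lemma diff_digit_set:
  assumes "digit_system A r" "digit_system A' r" and A': "\<And>a b. a \<in> A \<Longrightarrow> b \<in> A \<Longrightarrow> a - b \<in> A'"
    and "p \<in> digit_set A r" "q \<in> digit_set A r"
  shows "p - q \<in> digit_set A' r"
proof -
  interpret A: digit_system A r by fact
  interpret A': digit_system A' r by fact
  obtain a where a: "\<And>j. a j \<in> A" and p: "p = digit_value r a"
    using assms(4) unfolding digit_set_def by blast
  obtain b where b: "\<And>j. b j \<in> A" and q: "q = digit_value r b"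
    using assms(5) unfolding digit_set_def by blast
  have "p - q = digit_value r (\<lambda>j. a j - b j)"
    unfolding p q digit_value_def
    by (simp add: suminf_diff[OF A.summable_digits[OF a] A.summable_digits[OF b]] left_diff_distrib)
  then show ?thesis using A' a b by (auto simp: digit_set_def)
qed

section \<open>Coverings by boxes and Hausdorff dimension\<close>

text \<open>For \<open>0 < r < 1\<close> and \<open>N >= 1\<close> this bounds the upper box
  dimension by \<open>log N / log (1 / r)\<close>. Boxes in the maximum norm are used because their
  counts and volumes multiply over coordinates.\<close>

definition box_covered :: "nat \<Rightarrow> real \<Rightarrow> (real ^ 'n::finite) set \<Rightarrow> bool" where
  "box_covered N r S \<longleftrightarrow> (\<exists>B\<ge>0. \<forall>n. \<exists>F. finite F \<and> card F \<le> N ^ n \<and>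
     (\<forall>x\<in>S. \<exists>y\<in>F. \<forall>i. \<bar>x $ i - y $ i\<bar> \<le> B * r ^ n))"

lemma power_powr_swap: "(x ^ n) powr a = (x powr a) ^ n" if "0 < x" for x a :: real
  by (induction n) (use that in \<open>simp_all add: powr_mult\<close>)

lemma diameter_box_le:
  fixes y :: "real ^ 'n::finite"
  assumes "0 \<le> \<rho>"
  shows "bounded {x. \<forall>i. \<bar>x $ i - y $ i\<bar> \<le> \<rho>}"
    and "diameter {x. \<forall>i. \<bar>x $ i - y $ i\<bar> \<le> \<rho>} \<le> real CARD('n) * (2 * \<rho>)"
proof -
  let ?S = "{x. \<forall>i. \<bar>x $ i - y $ i\<bar> \<le> \<rho>}"
  have dist: "norm (x - x') \<le> real CARD('n) * (2 * \<rho>)" if "x \<in> ?S" "x' \<in> ?S" for x x'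
  proof -
    have "norm (x - x') \<le> (\<Sum>i\<in>UNIV. \<bar>(x - x') $ i\<bar>)" by (rule norm_le_l1_cart)
    also have "\<dots> \<le> (\<Sum>i\<in>(UNIV :: 'n set). 2 * \<rho>)"
    proof (rule sum_mono)
      fix i
      have "\<bar>x $ i - y $ i\<bar> \<le> \<rho>" "\<bar>x' $ i - y $ i\<bar> \<le> \<rho>" using that by auto
      then show "\<bar>(x - x') $ i\<bar> \<le> 2 * \<rho>" by simp
    qed
    finally show ?thesis by simp
  qed
  then show "bounded ?S"
    unfolding bounded_two_points dist_norm by blast
  show "diameter ?S \<le> real CARD('n) * (2 * \<rho>)"
    using assms dist by (intro diameter_le) auto
qed

text \<open>The \<open>N ^ n\<close> boxes of scale \<open>n\<close> contribute at most a constant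
  times \<open>(N * r powr s) ^ n\<close>, which tends to 0, while their diameters eventually fall
  below any \<open>\<delta>\<close>.\<close>

lemma hausdorff_measure_box_covered:
  fixes S :: "(real ^ 'n::finite) set"
  assumes "box_covered N r S" and r: "0 < r" "r < 1" and "s > 0" and small: "real N * r powr s < 1"
  shows "hausdorff_measure s S = 0"
proof -
  obtain B where "0 \<le> B" and B: "\<And>n. \<exists>F. finite F \<and> card F \<le> N ^ n \<and>
     (\<forall>x\<in>S. \<exists>y\<in>F. \<forall>i. \<bar>x $ i - y $ i\<bar> \<le> B * r ^ n)"
    using assms(1) unfolding box_covered_def by blast
  define c where "c = real CARD('n) * (2 * B)"
  have "0 \<le> c" using \<open>0 \<le> B\<close> by (simp add: c_def)
  have le: "hausdorff_premeasure s \<delta> S \<le> ennreal (c powr s * (real N * r powr s) ^ n)"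
    if small: "c * r ^ n \<le> \<delta>" for \<delta> n
  proof -
    obtain F where F: "finite F" "card F \<le> N ^ n"
      "\<And>x. x \<in> S \<Longrightarrow> \<exists>y\<in>F. \<forall>i. \<bar>x $ i - y $ i\<bar> \<le> B * r ^ n"
      using B[of n] by blast
    define box where "box y = {x. \<forall>i. \<bar>x $ i - y $ i\<bar> \<le> B * r ^ n}" for y :: "real ^ 'n"
    have box: "bounded (box y)" "diameter (box y) \<le> c * r ^ n" for y
      using diameter_box_le[of "B * r ^ n" y] \<open>0 \<le> B\<close> r by (simp_all add: box_def c_def mult_ac)
    have "0 \<le> \<delta>" using small \<open>0 \<le> c\<close> r by (smt (verit) mult_nonneg_nonneg zero_le_power)
    \<comment> \<open>A cover is an infinite sequence, so the finite family of boxes is padded with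
      empty sets, whose terms are 0 by convention.\<close>
    define U where "U j = (if j < card F then box (from_nat_into F j) else {})" for j
    have "S \<subseteq> (\<Union>j. U j)"
    proof
      fix x assume "x \<in> S"
      then obtain y where "y \<in> F" "x \<in> box y" using F(3) by (auto simp: box_def)
      moreover have "y \<in> from_nat_into F ` {..<card F}"
        using bij_betw_from_nat_into_finite[OF F(1)] \<open>y \<in> F\<close> by (simp add: bij_betw_def)
      then obtain j where "j < card F" "from_nat_into F j = y" by blast
      ultimately show "x \<in> (\<Union>j. U j)" by (auto simp: U_def)
    qed
    moreover have "bounded (U j) \<and> diameter (U j) \<le> \<delta>" for j
      using box small \<open>0 \<le> \<delta>\<close> by (auto simp: U_def diameter_empty intro: order_trans)
    ultimately have "hausdorff_premeasure s \<delta> S \<le> (\<Sum>j. diameter_powr s (U j))"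
      unfolding hausdorff_premeasure_def by (intro INF_lower) auto
    also have "\<dots> = (\<Sum>j<card F. diameter_powr s (U j))"
      by (rule suminf_finite) (auto simp: U_def diameter_powr_def)
    also have "\<dots> \<le> (\<Sum>j<card F. ennreal ((c * r ^ n) powr s))"
    proof (rule sum_mono)
      fix j
      have "diameter (U j) \<le> c * r ^ n \<or> U j = {}" using box by (simp add: U_def)
      moreover have "0 \<le> diameter (U j)" using box by (auto simp: U_def diameter_empty intro: diameter_ge_0)
      ultimately show "diameter_powr s (U j) \<le> ennreal ((c * r ^ n) powr s)"
        using \<open>s > 0\<close> by (auto simp: diameter_powr_def intro!: ennreal_leI powr_mono2)
    qed
    also have "\<dots> = ennreal (real (card F) * (c * r ^ n) powr s)"
      by (simp add: ennreal_mult ennreal_of_nat_eq_real_of_nat)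
    also have "\<dots> \<le> ennreal (real (N ^ n) * (c * r ^ n) powr s)"
      using F(2) by (intro ennreal_leI mult_right_mono) (simp_all only: of_nat_le_iff powr_ge_zero)
    also have "real (N ^ n) * (c * r ^ n) powr s = c powr s * (real N * r powr s) ^ n"
      using r \<open>0 \<le> c\<close> by (simp add: powr_mult power_powr_swap power_mult_distrib mult_ac)
    finally show ?thesis .
  qed
  have "hausdorff_premeasure s \<delta> S = 0" if "\<delta> > 0" for \<delta>
  proof -
    have "(\<lambda>n. c * r ^ n) \<longlonglongrightarrow> c * 0"
      using r by (intro tendsto_intros LIMSEQ_power_zero) auto
    then have "eventually (\<lambda>n. c * r ^ n < \<delta>) sequentially"
      using that by (intro order_tendstoD) auto
    then have ev: "eventually (\<lambda>n. hausdorff_premeasure s \<delta> S \<le> ennreal (c powr s * (real N * r powr s) ^ n)) sequentially"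
      by eventually_elim (simp add: le)
    have "(\<lambda>n. c powr s * (real N * r powr s) ^ n) \<longlonglongrightarrow> c powr s * 0"
      using small by (intro tendsto_intros LIMSEQ_power_zero) auto
    then have "(\<lambda>n. ennreal (c powr s * (real N * r powr s) ^ n)) \<longlonglongrightarrow> ennreal 0"
      by (intro tendsto_ennrealI) simp
    then have "hausdorff_premeasure s \<delta> S \<le> ennreal 0"
      using ev by (rule tendsto_lowerbound) simp
    then show ?thesis by simp
  qed
  then show ?thesis unfolding hausdorff_measure_def by (simp add: SUP_eq_const[of _ _ 0] bot_ennreal)
qed

lemma hausdorff_dim_eqI:
  fixes E :: "'a::metric_space set"
  assumes "0 \<le> s" and above: "\<And>t. s < t \<Longrightarrow> hausdorff_measure t E = 0"
    and below: "\<And>t. 0 \<le> t \<Longrightarrow> t \<le> s \<Longrightarrow> hausdorff_measure t E \<noteq> 0"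
  shows "hausdorff_dim E = ereal s"
  unfolding hausdorff_dim_def
proof -
  let ?T = "{ereal t |t. 0 \<le> t \<and> hausdorff_measure t E = 0}"
  have "Inf ?T \<le> ereal s"
  proof (rule ereal_le_epsilon2)
    fix e :: real assume "0 < e"
    then have "ereal (s + e) \<in> ?T" using above[of "s + e"] \<open>0 \<le> s\<close> by auto
    then have "Inf ?T \<le> ereal (s + e)" by (rule Inf_lower)
    then show "Inf ?T \<le> ereal s + ereal e" by simp
  qed
  moreover have "ereal s \<le> Inf ?T"
  proof (rule Inf_greatest)
    fix y assume "y \<in> ?T"
    then obtain t where t: "y = ereal t" "0 \<le> t" "hausdorff_measure t E = 0" by blast
    then have "\<not> t \<le> s" using below by blast
    then show "ereal s \<le> y" using t by simp
  qed
  ultimately show "Inf ?T = ereal s" by (rule antisym)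
qed

section \<open>Positive Hausdorff measure by comparison with Lebesgue measure\<close>

lemma emeasure_lborel_cube:
  fixes t :: "real ^ 'n::finite"
  assumes "0 \<le> \<rho>"
  shows "emeasure lborel (cbox (t - (\<chi> i. \<rho>)) (t + (\<chi> i. \<rho>))) = ennreal ((2 * \<rho>) ^ CARD('n))"
proof -
  have "(\<Prod>b\<in>(Basis :: (real ^ 'n) set). (t + (\<chi> i. \<rho>) - (t - (\<chi> i. \<rho>))) \<bullet> b) = (\<Prod>b\<in>(Basis :: (real ^ 'n) set). 2 * \<rho>)"
    by (rule prod.cong) (auto simp: Basis_vec_def inner_axis)
  also have "\<dots> = (2 * \<rho>) ^ CARD('n)" by simp
  finally show ?thesis
    using assms by (subst emeasure_lborel_cbox) (auto simp: Basis_vec_def inner_axis)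
qed

text \<open>For \<open>x = 0\<close> and \<open>n = 0\<close> the sides would be 1 and
  \<open>0 powr 0 = 0\<close>, hence the condition on \<open>n\<close>.\<close>

lemma powr_power_eq: "(x powr a) ^ n = x powr (a * real n)" if "0 \<le> x" "0 < n" for x a :: real
  using that by (cases "x = 0") (simp_all add: powr_powr flip: powr_realpow)

text \<open>Bounds a cover of \<open>E\<close> from below by transporting it, along a Hoelder correspondence \<open>R\<close>, to a
  cover of the unit cube.\<close>

lemma hausdorff_measure_pos:
  fixes E :: "'a::metric_space set" and R :: "'a \<Rightarrow> real ^ 'n::finite \<Rightarrow> bool"
  assumes onto: "\<And>t. (\<forall>i. 0 \<le> t $ i \<and> t $ i \<le> 1) \<Longrightarrow> \<exists>x\<in>E. R x t"
    and hoelder: "\<And>x t x' t' i. R x t \<Longrightarrow> R x' t' \<Longrightarrow> \<bar>t $ i - t' $ i\<bar> \<le> K * dist x x' powr \<alpha>"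
    and "K > 0" and "\<alpha> > 0" and u: "0 \<le> u" "u \<le> \<alpha> * real CARD('n)"
  shows "hausdorff_measure u E \<noteq> 0"
proof -
  define c where "c = (2 * K) ^ CARD('n)"
  have "c > 0" using \<open>K > 0\<close> by (simp add: c_def)
  \<comment> \<open>Scale 1 is enough, the measure being a supremum over scales. Diameters at most 1
    allow the exponent \<open>\<alpha> * CARD('n)\<close> of the cube volumes to be lowered to
    \<open>u\<close>; \<open>c\<close> is the constant in those volumes.\<close>
  have "ennreal (1 / c) \<le> hausdorff_premeasure u 1 E"
    unfolding hausdorff_premeasure_def
  proof (rule INF_greatest)
    fix U :: "nat \<Rightarrow> 'a set"
    assume "U \<in> {U. E \<subseteq> (\<Union>i. U i) \<and> (\<forall>i. bounded (U i) \<and> diameter (U i) \<le> 1)}"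
    then have U: "E \<subseteq> (\<Union>i. U i)" "\<And>i. bounded (U i)" "\<And>i. diameter (U i) \<le> 1" by auto
    define V where "V j = {t. \<exists>x\<in>U j. R x t}" for j
    \<comment> \<open>\<open>V j\<close> may fail to be measurable, so it is enclosed in a cube
      centred at one of its points with half-side
      \<open>K * diameter (U j) powr \<alpha>\<close>.\<close>
    have "\<exists>W. W \<in> sets lborel \<and> V j \<subseteq> W \<and> emeasure lborel W \<le> ennreal c * diameter_powr u (U j)" for j
    proof (cases "V j = {}")
      case True
      then show ?thesis by (intro exI[of _ "{}"]) auto
    next
      case False
      then obtain t x where t: "x \<in> U j" "R x t" by (auto simp: V_def)
      define \<rho> where "\<rho> = K * diameter (U j) powr \<alpha>"
      have d0: "0 \<le> diameter (U j)" using U(2) by (rule diameter_ge_0)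
      have "0 \<le> \<rho>" using \<open>K > 0\<close> by (simp add: \<rho>_def)
      let ?W = "cbox (t - (\<chi> i. \<rho>)) (t + (\<chi> i. \<rho>))"
      have "V j \<subseteq> ?W"
      proof
        fix t' assume "t' \<in> V j"
        then obtain x' where t': "x' \<in> U j" "R x' t'" by (auto simp: V_def)
        have "\<bar>t' $ i - t $ i\<bar> \<le> \<rho>" for i
        proof -
          have "dist x' x \<le> diameter (U j)" using U(2) t' t by (intro diameter_bounded_bound)
          then have "dist x' x powr \<alpha> \<le> diameter (U j) powr \<alpha>"
            using \<open>\<alpha> > 0\<close> by (intro powr_mono2) auto
          then have "K * dist x' x powr \<alpha> \<le> \<rho>"
            using \<open>K > 0\<close> by (simp add: \<rho>_def)
          then show ?thesis using hoelder[OF t'(2) t(2), of i] by linarith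
        qed
        then show "t' \<in> ?W" unfolding mem_box_cart by (simp add: abs_le_iff algebra_simps)
      qed
      moreover have "emeasure lborel ?W \<le> ennreal c * diameter_powr u (U j)"
      proof -
        have "(2 * \<rho>) ^ CARD('n) = c * (diameter (U j) powr \<alpha>) ^ CARD('n)"
          by (simp add: \<rho>_def c_def power_mult_distrib)
        also have "(diameter (U j) powr \<alpha>) ^ CARD('n) = diameter (U j) powr (\<alpha> * real CARD('n))"
          using d0 by (simp add: powr_power_eq)
        finally have eq: "(2 * \<rho>) ^ CARD('n) = c * diameter (U j) powr (\<alpha> * real CARD('n))" .
        \<comment> \<open>The case \<open>u = 0\<close> follows the convention of
          \<open>diameter_powr\<close> that a nonempty set has term 1, even when its diameter is
          0.\<close>
        have "diameter (U j) powr (\<alpha> * real CARD('n)) \<le> (if u = 0 then 1 else diameter (U j) powr u)"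
          using u d0 U(3)[of j] \<open>\<alpha> > 0\<close> by (auto intro: powr_le1 powr_mono')
        then have "ennreal (diameter (U j) powr (\<alpha> * real CARD('n))) \<le> diameter_powr u (U j)"
          using t(1) by (auto simp: diameter_powr_def ennreal_leI split: if_splits simp flip: ennreal_1)
        then have "ennreal c * ennreal (diameter (U j) powr (\<alpha> * real CARD('n))) \<le> ennreal c * diameter_powr u (U j)"
          by (rule mult_left_mono) simp
        then show ?thesis
          unfolding emeasure_lborel_cube[OF \<open>0 \<le> \<rho>\<close>] eq using \<open>c > 0\<close> by (simp add: ennreal_mult)
      qed
      ultimately show ?thesis by (intro exI[of _ ?W]) auto
    qed
    then obtain W where W: "\<And>j. W j \<in> sets lborel" "\<And>j. V j \<subseteq> W j"
      "\<And>j. emeasure lborel (W j) \<le> ennreal c * diameter_powr u (U j)" by metis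
    have "cbox 0 (\<chi> i. 1 :: real ^ 'n) \<subseteq> (\<Union>j. W j)"
    proof
      fix t :: "real ^ 'n" assume "t \<in> cbox 0 (\<chi> i. 1)"
      then have "\<forall>i. 0 \<le> t $ i \<and> t $ i \<le> 1" by (simp add: mem_box_cart)
      then obtain x where "x \<in> E" "R x t" using onto by blast
      then obtain j where "x \<in> U j" using U(1) by blast
      then have "t \<in> V j" using \<open>R x t\<close> by (auto simp: V_def)
      then show "t \<in> (\<Union>j. W j)" using W(2) by blast
    qed
    then have "emeasure lborel (cbox 0 (\<chi> i. 1 :: real ^ 'n)) \<le> emeasure lborel (\<Union>j. W j)"
      using W(1) by (intro emeasure_mono) auto
    moreover have "cbox 0 (\<chi> i. 1 :: real ^ 'n) = cbox ((\<chi> i. 1/2) - (\<chi> i. 1/2)) ((\<chi> i. 1/2) + (\<chi> i. 1/2))"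
      by (simp add: set_eq_iff mem_box_cart)
    ultimately have "1 \<le> emeasure lborel (\<Union>j. W j)"
      using emeasure_lborel_cube[of "1/2" "(\<chi> i. 1/2) :: real ^ 'n"] by simp
    also have "\<dots> \<le> (\<Sum>j. emeasure lborel (W j))"
      using W(1) by (intro emeasure_subadditive_countably) auto
    also have "\<dots> \<le> (\<Sum>j. ennreal c * diameter_powr u (U j))"
      using W(3) by (intro suminf_le) auto
    also have "\<dots> = ennreal c * (\<Sum>j. diameter_powr u (U j))" by simp
    finally have "ennreal (1 / c) * 1 \<le> ennreal (1 / c) * (ennreal c * (\<Sum>j. diameter_powr u (U j)))"
      by (rule mult_left_mono) simp
    also have "\<dots> = (\<Sum>j. diameter_powr u (U j))"
      using \<open>c > 0\<close> by (simp add: mult.assoc[symmetric] ennreal_mult[symmetric])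
    finally show "ennreal (1 / c) \<le> (\<Sum>j. diameter_powr u (U j))" by simp
  qed
  also have "\<dots> \<le> hausdorff_measure u E"
    unfolding hausdorff_measure_def by (rule SUP_upper) simp
  finally show ?thesis using \<open>c > 0\<close> by (auto simp: ennreal_eq_0_iff)
qed

section \<open>Products of digit sets and their distance sets\<close>

definition digit_cube :: "real set \<Rightarrow> real \<Rightarrow> (real ^ 'd::finite) set" where
  "digit_cube A r = {x. \<forall>c. x $ c \<in> digit_set A r}"

lemma compact_digit_cube:
  assumes "digit_system A r"
  shows "compact (digit_cube A r :: (real ^ 'd::finite) set)"
proof -
  interpret digit_system A r by fact
  let ?E = "digit_cube A r :: (real ^ 'd) set"
  obtain B where B: "\<And>p. p \<in> digit_set A r \<Longrightarrow> \<bar>p\<bar> \<le> B"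
    using bounded_digit_set by (auto simp: bounded_iff)
  have "norm x \<le> (\<Sum>c\<in>(UNIV :: 'd set). B)" if "x \<in> ?E" for x
  proof -
    have "norm x \<le> (\<Sum>c\<in>UNIV. \<bar>x $ c\<bar>)" by (rule norm_le_l1_cart)
    also have "\<dots> \<le> (\<Sum>c\<in>(UNIV :: 'd set). B)"
      using that B by (intro sum_mono) (simp add: digit_cube_def)
    finally show ?thesis .
  qed
  then have "bounded ?E" unfolding bounded_iff by blast
  moreover have "closed ((\<lambda>x :: real ^ 'd. x $ c) -` digit_set A r)" for c
    by (intro closed_vimage compact_imp_closed[OF compact_digit_set] continuous_intros)
  then have "closed (\<Inter>c. (\<lambda>x :: real ^ 'd. x $ c) -` digit_set A r)" by (intro closed_INT) auto
  moreover have "(\<Inter>c. (\<lambda>x :: real ^ 'd. x $ c) -` digit_set A r) = ?E"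
    by (auto simp: digit_cube_def)
  ultimately show ?thesis by (simp add: compact_eq_bounded_closed)
qed

lemma box_covered_digit_cube:
  assumes "digit_system A r"
  shows "box_covered (card A ^ CARD('d)) r (digit_cube A r :: (real ^ 'd::finite) set)"
proof -
  interpret digit_system A r by fact
  obtain B where "B \<ge> 0" and B: "\<And>n. \<exists>F. finite F \<and> card F \<le> card A ^ n \<and> (\<forall>p\<in>digit_set A r. \<exists>y\<in>F. \<bar>p - y\<bar> \<le> B * r ^ n)"
    using digit_set_cover by blast
  have "\<exists>F :: (real ^ 'd) set. finite F \<and> card F \<le> (card A ^ CARD('d)) ^ n \<and>
     (\<forall>x\<in>digit_cube A r. \<exists>y\<in>F. \<forall>i. \<bar>x $ i - y $ i\<bar> \<le> B * r ^ n)" for n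
  proof -
    obtain F where F: "finite F" "card F \<le> card A ^ n" "\<And>p. p \<in> digit_set A r \<Longrightarrow> \<exists>y\<in>F. \<bar>p - y\<bar> \<le> B * r ^ n"
      using B[of n] by blast
    define F' :: "(real ^ 'd) set" where "F' = (\<lambda>f. \<chi> c. f c) ` (UNIV \<rightarrow>\<^sub>E F)"
    have "card F' \<le> card (UNIV \<rightarrow>\<^sub>E F :: ('d \<Rightarrow> real) set)"
      unfolding F'_def using F(1) by (intro card_image_le finite_PiE) auto
    also have "\<dots> = card F ^ CARD('d)" by (simp add: card_PiE)
    also have "\<dots> \<le> (card A ^ n) ^ CARD('d)" using F(2) by (rule power_mono) simp
    also have "\<dots> = (card A ^ CARD('d)) ^ n" by (simp add: mult.commute flip: power_mult)
    finally have "card F' \<le> (card A ^ CARD('d)) ^ n" .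
    moreover have "finite F'" unfolding F'_def using F(1) by (intro finite_imageI finite_PiE) auto
    moreover have "\<exists>y\<in>F'. \<forall>c. \<bar>x $ c - y $ c\<bar> \<le> B * r ^ n" if "x \<in> digit_cube A r" for x :: "real ^ 'd"
    proof -
      have "\<forall>c. \<exists>y. y \<in> F \<and> \<bar>x $ c - y\<bar> \<le> B * r ^ n"
        using that F(3) unfolding digit_cube_def by blast
      then obtain f where f: "\<And>c. f c \<in> F" "\<And>c. \<bar>x $ c - f c\<bar> \<le> B * r ^ n" by metis
      have "(\<chi> c. f c) \<in> F'" unfolding F'_def using f(1) by (intro imageI) auto
      then show ?thesis using f(2) by (intro bexI[of _ "\<chi> c. f c"]) simp_all
    qed
    ultimately show ?thesis by blast
  qed
  then show ?thesis unfolding box_covered_def using \<open>B \<ge> 0\<close> by blast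
qed

text \<open>Distances only depend on the differences to the point at one base vertex, so the exponent is
  \<open>k * d\<close> rather than \<open>(k + 1) * d\<close>.\<close>

lemma box_covered_distance_set:
  fixes G :: "('v::{finite,linorder} \<times> 'v) set"
  assumes "digit_system A r" and A': "digit_system A' r"
    and diff: "\<And>a b. a \<in> A \<Longrightarrow> b \<in> A \<Longrightarrow> a - b \<in> A'" and k: "CARD('v) = k + 1"
  shows "box_covered (card A' ^ (k * CARD('d))) r
    (distance_set G (tuples_in (digit_cube A r :: (real ^ 'd::finite) set)))"
proof -
  interpret A': digit_system A' r by fact
  obtain B where "B \<ge> 0" and B: "\<And>n. \<exists>F. finite F \<and> card F \<le> card A' ^ n \<and> (\<forall>p\<in>digit_set A' r. \<exists>y\<in>F. \<bar>p - y\<bar> \<le> B * r ^ n)"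
    using A'.digit_set_cover by blast
  \<comment> \<open>Any vertex can serve as the base vertex.\<close>
  define v0 :: 'v where "v0 = undefined"
  define I where "I = (- {v0}) \<times> (UNIV :: 'd set)"
  have "card I = k * CARD('d)"
    using k by (simp add: I_def card_cartesian_product Compl_eq_Diff_UNIV)
  \<comment> \<open>\<open>f\<close> lists approximate coordinates of the differences to the base
    point. \<open>ext f w\<close> then approximates the point at \<open>w\<close> minus the point at
    \<open>v0\<close>, with exact value 0 at \<open>v0\<close>, and \<open>dst f\<close>
    approximates the vector of distances.\<close>
  define ext where "ext f w = (\<chi> c. if w = v0 then 0 else f (w, c))" for f :: "'v \<times> 'd \<Rightarrow> real" and w
  define dst where "dst f = (\<chi> e. if e \<in> G then norm (ext f (fst e) - ext f (snd e)) else 0)" for f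
  let ?S = "distance_set G (tuples_in (digit_cube A r :: (real ^ 'd) set))"
  \<comment> \<open>Each edge involves two approximated differences, so a coordinate is off by at
    most \<open>2 * B * r ^ n\<close>; summing over the coordinates bounds the error of the
    norm.\<close>
  let ?B = "real CARD('d) * (2 * B)"
  have "\<exists>F. finite F \<and> card F \<le> (card A' ^ (k * CARD('d))) ^ n \<and>
     (\<forall>x\<in>?S. \<exists>y\<in>F. \<forall>i. \<bar>x $ i - y $ i\<bar> \<le> ?B * r ^ n)" for n
  proof -
    obtain F where F: "finite F" "card F \<le> card A' ^ n" "\<And>p. p \<in> digit_set A' r \<Longrightarrow> \<exists>y\<in>F. \<bar>p - y\<bar> \<le> B * r ^ n"
      using B[of n] by blast
    let ?\<rho> = "B * r ^ n"
    have "?\<rho> \<ge> 0" using \<open>B \<ge> 0\<close> A'.ratio_pos by simp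
    define F' where "F' = dst ` (I \<rightarrow>\<^sub>E F)"
    have fin: "finite (I \<rightarrow>\<^sub>E F)" using F(1) by (intro finite_PiE) auto
    have "card F' \<le> card (I \<rightarrow>\<^sub>E F)"
      unfolding F'_def by (rule card_image_le[OF fin])
    also have "\<dots> = card F ^ (k * CARD('d))" using \<open>card I = _\<close> by (simp add: card_PiE)
    also have "\<dots> \<le> (card A' ^ n) ^ (k * CARD('d))" using F(2) by (rule power_mono) simp
    also have "\<dots> = (card A' ^ (k * CARD('d))) ^ n" by (simp add: mult_ac flip: power_mult)
    finally have "card F' \<le> (card A' ^ (k * CARD('d))) ^ n" .
    moreover have "finite F'" unfolding F'_def using fin by simp
    moreover have "\<exists>y\<in>F'. \<forall>i. \<bar>z $ i - y $ i\<bar> \<le> ?B * r ^ n" if "z \<in> ?S" for z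
    proof -
      obtain x :: "real ^ ('v \<times> 'd)" where z: "z = dist_map G x" and x: "x \<in> tuples_in (digit_cube A r)"
        using \<open>z \<in> ?S\<close> unfolding distance_set_def by blast
      have "point x w $ c \<in> digit_set A r" for w c
        using x by (simp add: tuples_in_def digit_cube_def)
      then have "point x w $ c - point x v0 $ c \<in> digit_set A' r" for w c
        using diff_digit_set[OF assms(1,2) diff] by blast
      then have "\<forall>i. \<exists>y. y \<in> F \<and> \<bar>point x (fst i) $ snd i - point x v0 $ snd i - y\<bar> \<le> ?\<rho>"
        using F(3) by blast
      then obtain g where g: "\<And>i. g i \<in> F" "\<And>i. \<bar>point x (fst i) $ snd i - point x v0 $ snd i - g i\<bar> \<le> ?\<rho>"
        by metis
      define f where "f = restrict g I"
      have f: "f \<in> I \<rightarrow>\<^sub>E F" using g(1) by (auto simp: f_def)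
      have approx: "\<bar>(point x w - point x v0 - ext f w) $ c\<bar> \<le> ?\<rho>" for w c
        using g(2)[of "(w, c)"] \<open>?\<rho> \<ge> 0\<close> by (cases "w = v0") (simp_all add: ext_def f_def I_def)
      have "\<bar>norm (point x a - point x b) - norm (ext f a - ext f b)\<bar> \<le> ?B * r ^ n" for a b
      proof -
        have "\<bar>norm (point x a - point x b) - norm (ext f a - ext f b)\<bar>
            \<le> norm ((point x a - point x b) - (ext f a - ext f b))"
          by (rule norm_triangle_ineq3)
        also have "\<dots> \<le> (\<Sum>c\<in>UNIV. \<bar>((point x a - point x b) - (ext f a - ext f b)) $ c\<bar>)"
          by (rule norm_le_l1_cart)
        also have "\<dots> \<le> (\<Sum>c\<in>(UNIV :: 'd set). 2 * ?\<rho>)"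
        proof (rule sum_mono)
          fix c
          show "\<bar>((point x a - point x b) - (ext f a - ext f b)) $ c\<bar> \<le> 2 * ?\<rho>"
            using approx[of a c] approx[of b c] unfolding vector_minus_component by linarith
        qed
        also have "\<dots> = ?B * r ^ n" by simp
        finally show ?thesis .
      qed
      moreover have "0 \<le> ?B * r ^ n" using \<open>B \<ge> 0\<close> A'.ratio_pos by simp
      ultimately have "\<bar>z $ i - dst f $ i\<bar> \<le> ?B * r ^ n" for i
        by (simp add: z dist_map_def dst_def)
      moreover have "dst f \<in> F'" using f by (simp add: F'_def)
      ultimately show ?thesis by blast
    qed
    ultimately show ?thesis by blast
  qed
  moreover have "?B \<ge> 0" using \<open>B \<ge> 0\<close> by simp
  ultimately show ?thesis unfolding box_covered_def by blast
qed

text \<open>Projected to the coordinates in \<open>G\<close>, the boxes of scale \<open>n\<close>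
  have total volume at most a constant times \<open>(N * r ^ card G) ^ n\<close>, which tends to
  0.\<close>

lemma null_edge_coords_box_covered:
  fixes S :: "(real ^ ('v::finite \<times> 'v)) set" and G :: "('v \<times> 'v) set"
  assumes "box_covered N r S" and "0 < r" and small: "real N * r ^ card G < 1"
  shows "edge_coords G ` S \<in> null_sets (lebesgue_edges G)"
proof -
  interpret product_sigma_finite "\<lambda>_ :: 'v \<times> 'v. lborel :: real measure" by standard
  let ?M = "Pi\<^sub>M G (\<lambda>_. lborel :: real measure)"
  obtain B where "0 \<le> B" and "\<forall>n. \<exists>F. finite F \<and> card F \<le> N ^ n \<and>
     (\<forall>x\<in>S. \<exists>y\<in>F. \<forall>i. \<bar>x $ i - y $ i\<bar> \<le> B * r ^ n)"
    using assms(1) unfolding box_covered_def by blast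
  then obtain F where F: "\<And>n. finite (F n)" "\<And>n. card (F n) \<le> N ^ n"
    "\<And>n x. x \<in> S \<Longrightarrow> \<exists>y\<in>F n. \<forall>i. \<bar>x $ i - y $ i\<bar> \<le> B * r ^ n" by metis
  define box where "box n y = Pi\<^sub>E G (\<lambda>e. {y $ e - B * r ^ n .. y $ e + B * r ^ n})" for n and y :: "real ^ ('v \<times> 'v)"
  have box: "box n y \<in> sets ?M" for n y unfolding box_def by (intro sets_PiM_I_finite) auto
  have vol: "emeasure ?M (box n y) = ennreal ((2 * B * r ^ n) ^ card G)" for n y
  proof -
    have "emeasure ?M (box n y) = (\<Prod>e\<in>G. emeasure lborel {y $ e - B * r ^ n .. y $ e + B * r ^ n})"
      unfolding box_def by (intro emeasure_PiM) auto
    also have "\<dots> = (\<Prod>e\<in>G. ennreal (2 * B * r ^ n))"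
      using \<open>0 \<le> B\<close> \<open>0 < r\<close> by (intro prod.cong refl) simp
    also have "\<dots> = ennreal ((2 * B * r ^ n) ^ card G)"
      using \<open>0 \<le> B\<close> \<open>0 < r\<close> by (simp add: ennreal_power)
    finally show ?thesis .
  qed
  define Z where "Z n = (\<Union>y\<in>F n. box n y)" for n
  have Z: "Z n \<in> sets ?M" for n unfolding Z_def using F(1) box by (intro sets.finite_UN) auto
  \<comment> \<open>The intersection of the covers over all scales is a measurable null set
    containing the image. Passing to the completion then makes the image itself a null set.\<close>
  define N' where "N' = (\<Inter>n. Z n)"
  have N': "N' \<in> sets ?M" unfolding N'_def using Z by (intro sets.countable_INT) auto
  have le: "emeasure ?M N' \<le> ennreal ((2 * B) ^ card G * (real N * r ^ card G) ^ n)" for n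
  proof -
    have "emeasure ?M N' \<le> emeasure ?M (Z n)"
      using Z by (intro emeasure_mono) (auto simp: N'_def)
    also have "\<dots> \<le> (\<Sum>y\<in>F n. emeasure ?M (box n y))"
      unfolding Z_def using F(1) box by (intro emeasure_subadditive_finite) auto
    also have "\<dots> = ennreal (real (card (F n)) * (2 * B * r ^ n) ^ card G)"
      unfolding vol by (simp add: ennreal_mult' ennreal_of_nat_eq_real_of_nat)
    also have "\<dots> \<le> ennreal (real (N ^ n) * (2 * B * r ^ n) ^ card G)"
      using F(2)[of n] \<open>0 \<le> B\<close> \<open>0 < r\<close> by (intro ennreal_leI mult_right_mono) (simp_all only: of_nat_le_iff, simp)
    also have "real (N ^ n) * (2 * B * r ^ n) ^ card G = (2 * B) ^ card G * (real N * r ^ card G) ^ n"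
      by (simp add: power_mult_distrib mult_ac flip: power_mult)
    finally show ?thesis .
  qed
  have "(\<lambda>n. (2 * B) ^ card G * (real N * r ^ card G) ^ n) \<longlonglongrightarrow> (2 * B) ^ card G * 0"
    using small \<open>0 < r\<close> by (intro tendsto_intros LIMSEQ_power_zero) auto
  then have "(\<lambda>n. ennreal ((2 * B) ^ card G * (real N * r ^ card G) ^ n)) \<longlonglongrightarrow> ennreal 0"
    by (intro tendsto_ennrealI) simp
  then have "emeasure ?M N' \<le> ennreal 0"
    by (rule tendsto_lowerbound[OF _ always_eventually]) (intro allI le, simp)
  then have "N' \<in> null_sets ?M" using N' by (simp add: null_sets_def)
  moreover have "edge_coords G ` S \<subseteq> N'"
  proof (intro image_subsetI)
    fix x assume "x \<in> S"
    have "edge_coords G x \<in> Z n" for n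
    proof -
      obtain y where y: "y \<in> F n" "\<And>i. \<bar>x $ i - y $ i\<bar> \<le> B * r ^ n" using F(3)[OF \<open>x \<in> S\<close>] by blast
      have "x $ e \<in> {y $ e - B * r ^ n .. y $ e + B * r ^ n}" for e
        using y(2)[of e] by (simp add: abs_le_iff)
      then have "edge_coords G x \<in> box n y" by (simp add: box_def edge_coords_def restrict_PiE_iff)
      then show ?thesis using y(1) by (auto simp: Z_def)
    qed
    then show "edge_coords G x \<in> N'" by (simp add: N'_def)
  qed
  ultimately show ?thesis
    unfolding lebesgue_edges_def null_sets_completion_iff2 by blast
qed

section \<open>Hausdorff dimension of the digit cube\<close>

lemma digit_system_nat: "0 < r \<Longrightarrow> r < 1 \<Longrightarrow> digit_system (real ` {..<M}) r"
  by unfold_locales auto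

lemma digit_set_nat_bounds:
  assumes r: "0 < r" "r < 1" and p: "p \<in> digit_set (real ` {..<M}) r"
  shows "0 \<le> p" and "p \<le> (real M - 1) / (1 - r)"
proof -
  interpret digit_system "real ` {..<M}" r using r by (rule digit_system_nat)
  obtain a where a: "\<And>j. a j \<in> real ` {..<M}" and p: "p = (\<Sum>j. a j * r ^ j)"
    using p unfolding digit_set_def digit_value_def by blast
  have bounds: "0 \<le> a j" "a j \<le> real M - 1" for j
  proof -
    obtain m where "m < M" "a j = real m" using a[of j] by blast
    then show "0 \<le> a j" "a j \<le> real M - 1" by simp_all
  qed
  have sums: "(\<lambda>j. (real M - 1) * r ^ j) sums ((real M - 1) * (1 / (1 - r)))"
    using r by (intro sums_mult geometric_sums) simp
  show "0 \<le> p" unfolding p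
    using bounds r by (intro suminf_nonneg summable_digits a) simp
  have "p \<le> (\<Sum>j. (real M - 1) * r ^ j)" unfolding p
    using bounds r by (intro suminf_le summable_digits a sums_summable[OF sums] mult_right_mono) simp_all
  then show "p \<le> (real M - 1) / (1 - r)" using sums_unique[OF sums] by simp
qed

lemma (in digit_system) digit_value_diff:
  assumes "\<And>j. a j \<in> A" "\<And>j. b j \<in> A" "\<And>j. j < n \<Longrightarrow> a j = b j"
  shows "digit_value r a - digit_value r b =
    r ^ n * (digit_value r (\<lambda>j. a (n + j)) - digit_value r (\<lambda>j. b (n + j)))"
  using assms
proof (induction n arbitrary: a b)
  case (Suc n)
  have "digit_value r a - digit_value r b =
      r * (digit_value r (\<lambda>j. a (Suc j)) - digit_value r (\<lambda>j. b (Suc j)))"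
    using digit_value_split[of a] digit_value_split[of b] Suc.prems by (simp add: right_diff_distrib)
  also have "\<dots> = r * (r ^ n * (digit_value r (\<lambda>j. a (Suc (n + j))) - digit_value r (\<lambda>j. b (Suc (n + j)))))"
    using Suc.IH[of "\<lambda>j. a (Suc j)" "\<lambda>j. b (Suc j)"] Suc.prems by simp
  finally show ?case by simp
qed simp

text \<open>Let \<open>n\<close> be the first position where the digits differ. To base
  \<open>1 / M\<close> the values differ by at most \<open>M * (1 / M) ^ n\<close>. To base
  \<open>r\<close> they differ by at least \<open>r ^ n * (1 - M * r)\<close>: digits differing by
  at least 1 cannot be compensated by tails contributing at most \<open>M * r\<close>. The choice of
  \<open>\<alpha>\<close> turns \<open>(r ^ n) powr \<alpha>\<close> into
  \<open>(1 / M) ^ n\<close>.\<close>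

lemma digit_value_hoelder:
  assumes r: "0 < r" and "M \<ge> 2" and gap: "real M * r < 1" and \<alpha>: "\<alpha> > 0" "r powr \<alpha> = 1 / real M"
    and a: "\<And>j. a j \<in> real ` {..<M}" and b: "\<And>j. b j \<in> real ` {..<M}"
  shows "\<bar>digit_value (1 / real M) a - digit_value (1 / real M) b\<bar>
    \<le> real M / (1 - real M * r) powr \<alpha> * \<bar>digit_value r a - digit_value r b\<bar> powr \<alpha>"
proof (cases "a = b")
  case False
  have "r * 1 \<le> real M * r" using \<open>M \<ge> 2\<close> r by (simp add: mult_le_cancel_right)
  then have "r < 1" using gap by simp
  let ?A = "real ` {..<M}"
  define \<kappa> where "\<kappa> = 1 - real M * r"
  have "\<kappa> > 0" using gap by (simp add: \<kappa>_def)
  interpret r: digit_system ?A r using r \<open>r < 1\<close> by (rule digit_system_nat)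
  interpret M: digit_system ?A "1 / real M" using \<open>M \<ge> 2\<close> by (intro digit_system_nat) simp_all
  define n where "n = (LEAST j. a j \<noteq> b j)"
  have "\<exists>j. a j \<noteq> b j" using False by auto
  then have n: "a n \<noteq> b n" unfolding n_def by (rule LeastI_ex)
  have eq: "a j = b j" if "j < n" for j using not_less_Least[of j "\<lambda>j. a j \<noteq> b j"] that by (simp add: n_def)
  define a' b' where "a' = (\<lambda>j. a (n + j))" and "b' = (\<lambda>j. b (n + j))"
  have a': "\<And>j. a' j \<in> ?A" and b': "\<And>j. b' j \<in> ?A" using a b by (simp_all add: a'_def b'_def)
  have mem: "digit_value t c \<in> digit_set ?A t" if "\<And>j. c j \<in> ?A" for c t
    using that by (auto simp: digit_set_def)
  have diff_M: "digit_value (1 / real M) a - digit_value (1 / real M) b =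
      (1 / real M) ^ n * (digit_value (1 / real M) a' - digit_value (1 / real M) b')"
    unfolding a'_def b'_def by (intro M.digit_value_diff a b eq)
  have diff_r: "digit_value r a - digit_value r b = r ^ n * (digit_value r a' - digit_value r b')"
    unfolding a'_def b'_def by (intro r.digit_value_diff a b eq)
  have "\<bar>digit_value (1 / real M) a' - digit_value (1 / real M) b'\<bar> \<le> real M"
  proof -
    have "(real M - 1) / (1 - 1 / real M) = real M" using \<open>M \<ge> 2\<close> by (simp add: field_simps)
    then have "0 \<le> x \<and> x \<le> real M" if "x \<in> digit_set ?A (1 / real M)" for x
      using digit_set_nat_bounds[OF M.ratio_pos M.ratio_less_1 that] by simp
    from this[OF mem[of a']] this[OF mem[of b']] show ?thesis using a' b' by (simp add: abs_le_iff)
  qed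
  then have "\<bar>digit_value (1 / real M) a - digit_value (1 / real M) b\<bar> \<le> (1 / real M) ^ n * real M"
    unfolding diff_M abs_mult
    using \<open>M \<ge> 2\<close> by (intro mult_mono) (simp_all add: abs_of_nonneg)
  also have "(1 / real M) ^ n = (r ^ n) powr \<alpha>" using r by (simp add: power_powr_swap \<alpha>(2))
  also have "\<dots> \<le> (\<bar>digit_value r a - digit_value r b\<bar> / \<kappa>) powr \<alpha>"
  proof (rule powr_mono2)
    let ?x = "digit_value r (\<lambda>j. a' (Suc j))" and ?y = "digit_value r (\<lambda>j. b' (Suc j))"
    obtain i j where ij: "a' 0 = real i" "b' 0 = real j" using a'[of 0] b'[of 0] by blast
    moreover have "a' 0 \<noteq> b' 0" using n by (simp add: a'_def b'_def)
    ultimately have "i \<noteq> j" by auto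
    then have "1 \<le> \<bar>a' 0 - b' 0\<bar>" unfolding ij by linarith
    moreover have "r * \<bar>?x - ?y\<bar> \<le> 1 - \<kappa>"
    proof -
      have bd: "0 \<le> x \<and> x \<le> (real M - 1) / (1 - r)" if "x \<in> digit_set ?A r" for x
        using digit_set_nat_bounds[OF r \<open>r < 1\<close> that] by simp
      have "\<bar>?x - ?y\<bar> \<le> (real M - 1) / (1 - r)"
        using bd[OF mem[of "\<lambda>j. a' (Suc j)"]] bd[OF mem[of "\<lambda>j. b' (Suc j)"]] a' b' by (simp add: abs_le_iff)
      \<comment> \<open>After clearing the denominator this is exactly
        \<open>M * r <= 1\<close>.\<close>
      also have "\<dots> \<le> real M"
        using gap \<open>r < 1\<close> by (simp add: field_simps)
      finally have "r * \<bar>?x - ?y\<bar> \<le> r * real M" using r by (intro mult_left_mono) simp_all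
      then show ?thesis by (simp add: \<kappa>_def mult.commute)
    qed
    moreover have "digit_value r a' - digit_value r b' = (a' 0 - b' 0) + r * (?x - ?y)"
      using r.digit_value_split[of a'] r.digit_value_split[of b'] a' b' by (simp add: algebra_simps)
    moreover have "\<bar>r * (?x - ?y)\<bar> = r * \<bar>?x - ?y\<bar>" using r by (simp add: abs_mult)
    ultimately have "\<kappa> \<le> \<bar>digit_value r a' - digit_value r b'\<bar>" by linarith
    then have "r ^ n * \<kappa> \<le> r ^ n * \<bar>digit_value r a' - digit_value r b'\<bar>" using r by (intro mult_left_mono) simp_all
    also have "\<dots> = \<bar>digit_value r a - digit_value r b\<bar>"
      unfolding diff_r abs_mult using r by simp
    finally show "r ^ n \<le> \<bar>digit_value r a - digit_value r b\<bar> / \<kappa>" using \<open>\<kappa> > 0\<close> by (simp add: field_simps)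
  qed (use \<alpha> r in simp_all)
  also have "\<dots> * real M = real M / \<kappa> powr \<alpha> * \<bar>digit_value r a - digit_value r b\<bar> powr \<alpha>"
    using \<open>\<kappa> > 0\<close> by (simp add: powr_divide)
  finally show ?thesis using \<open>M \<ge> 2\<close> by (simp add: \<kappa>_def mult_right_mono)
qed simp

text \<open>Expansions start with the power 0, so the self-similar interval is
  \<open>{0..M}\<close>: it is the union of its copies shrunk by \<open>1 / M\<close> and translated
  by the digits.\<close>

lemma unit_interval_subset_digit_set:
  assumes "M \<ge> 2"
  shows "{0..1} \<subseteq> digit_set (real ` {..<M}) (1 / real M)"
proof -
  interpret digit_system "real ` {..<M}" "1 / real M" using assms by (intro digit_system_nat) simp_all
  have "{0..real M} \<subseteq> digit_set (real ` {..<M}) (1 / real M)"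
  proof (rule subset_digit_set)
    fix x assume x: "x \<in> {0..real M}"
    show "\<exists>a\<in>real ` {..<M}. \<exists>y\<in>{0..real M}. x = a + 1 / real M * y"
    proof (cases "x = real M")
      case True
      \<comment> \<open>At the right endpoint the floor would be \<open>M\<close>, which is no
        digit; this point is reproduced with the digit \<open>M - 1\<close> instead.\<close>
      have "real M - 1 \<in> real ` {..<M}"
        using assms by (intro image_eqI[of _ _ "M - 1"]) (simp_all add: of_nat_diff)
      moreover have "x = (real M - 1) + 1 / real M * real M" using True assms by simp
      moreover have "real M \<in> {0..real M}" by simp
      ultimately show ?thesis by blast
    next
      case False
      define m where "m = nat \<lfloor>x\<rfloor>"
      have m: "real m \<le> x" "x < real m + 1" using x by (simp_all add: m_def)
      then have "real m < real M" using x False by simp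
      then have "m < M" by simp
      moreover have "real M * (x - real m) \<in> {0..real M}" using m assms by (simp add: mult_left_le)
      moreover have "x = real m + 1 / real M * (real M * (x - real m))" using assms by simp
      ultimately show ?thesis by blast
    qed
  qed simp
  moreover have "{0..1} \<subseteq> {0..real M}" using assms by simp
  ultimately show ?thesis by blast
qed

text \<open>Reading the digits of every coordinate to base \<open>1 / M\<close> in place of
  \<open>r\<close> gives a Hoelder correspondence that reaches the whole unit cube.\<close>

lemma hausdorff_measure_digit_cube_nonzero:
  assumes r: "0 < r" and M: "M \<ge> 2" and gap: "real M * r < 1" and \<alpha>: "\<alpha> > 0" "r powr \<alpha> = 1 / real M"
    and u: "0 \<le> u" "u \<le> \<alpha> * real CARD('d)"
  shows "hausdorff_measure u (digit_cube (real ` {..<M}) r :: (real ^ 'd::finite) set) \<noteq> 0"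
proof -
  let ?A = "real ` {..<M}"
  \<comment> \<open>A relation is used because \<open>t\<close> determines \<open>x\<close> only up
    to the choice of expansions: numbers may have two expansions to base
    \<open>1 / M\<close>.\<close>
  define R where "R x t \<longleftrightarrow> (\<forall>c. \<exists>a. (\<forall>j. a j \<in> ?A) \<and> x $ c = digit_value r a \<and> t $ c = digit_value (1 / real M) a)"
    for x t :: "real ^ 'd"
  define K where "K = real M / (1 - real M * r) powr \<alpha>"
  have "K > 0" using M gap by (simp add: K_def)
  show ?thesis
  proof (rule hausdorff_measure_pos[of _ R K \<alpha>])
    fix t :: "real ^ 'd" assume t: "\<forall>c. 0 \<le> t $ c \<and> t $ c \<le> 1"
    have "\<exists>a. (\<forall>j. a j \<in> ?A) \<and> t $ c = digit_value (1 / real M) a" for c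
    proof -
      have "t $ c \<in> digit_set ?A (1 / real M)"
        using unit_interval_subset_digit_set[OF M] t by (simp add: subset_iff)
      then show ?thesis unfolding digit_set_def by blast
    qed
    then obtain a where a: "\<And>c j. a c j \<in> ?A" "\<And>c. t $ c = digit_value (1 / real M) (a c)" by metis
    let ?x = "\<chi> c. digit_value r (a c)"
    have "?x \<in> digit_cube ?A r" using a(1) by (auto simp: digit_cube_def digit_set_def)
    moreover have "R ?x t" unfolding R_def using a by (intro allI exI[of _ "a c" for c]) simp
    ultimately show "\<exists>x\<in>digit_cube ?A r. R x t" by blast
  next
    fix x t x' t' :: "real ^ 'd" and c assume "R x t" "R x' t'"
    then obtain a b where a: "\<forall>j. a j \<in> ?A" "x $ c = digit_value r a" "t $ c = digit_value (1 / real M) a"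
      and b: "\<forall>j. b j \<in> ?A" "x' $ c = digit_value r b" "t' $ c = digit_value (1 / real M) b"
      unfolding R_def by meson
    have "\<bar>t $ c - t' $ c\<bar> \<le> K * \<bar>x $ c - x' $ c\<bar> powr \<alpha>"
      unfolding a(2,3) b(2,3) K_def using a(1) b(1) by (intro digit_value_hoelder r M gap \<alpha>) simp_all
    also have "\<dots> \<le> K * dist x x' powr \<alpha>"
    proof -
      have "\<bar>x $ c - x' $ c\<bar> \<le> dist x x'" using dist_vec_nth_le[of x c x'] by (simp add: dist_real_def)
      then show ?thesis using \<open>K > 0\<close> \<alpha> by (intro mult_left_mono powr_mono2) simp_all
    qed
    finally show "\<bar>t $ c - t' $ c\<bar> \<le> K * dist x x' powr \<alpha>" .
  qed (use \<open>K > 0\<close> \<alpha> u in simp_all)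
qed

text \<open>The ratio is chosen so that \<open>M ^ d * r powr s = 1\<close> with
  \<open>d = CARD('d)\<close>. Box counting gives the upper bound and the Hoelder exponent
  \<open>s / d\<close> the lower one; \<open>s < d\<close> is what makes \<open>M * r < 1\<close>,
  the separation of the pieces.\<close>

lemma hausdorff_dim_digit_cube:
  assumes M: "M \<ge> 2" and s: "0 < s" "s < real CARD('d)"
  defines "r \<equiv> real M powr (- (real CARD('d) / s))"
  shows "hausdorff_dim (digit_cube (real ` {..<M}) r :: (real ^ 'd::finite) set) = ereal s"
proof (rule hausdorff_dim_eqI)
  let ?d = "real CARD('d)"
  have r: "0 < r" using M by (simp add: r_def)
  have "real M * r = real M powr (1 + - (?d / s))"
    using M unfolding r_def powr_add by simp
  also have "\<dots> < 1"
    using M s by (intro powr_less_one) (simp_all add: field_simps)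
  finally have gap: "real M * r < 1" .
  moreover have "r * 1 \<le> real M * r" using M r by (simp add: mult_le_cancel_right)
  ultimately have "r < 1" by simp
  have card: "card (real ` {..<M}) = M" by (simp add: card_image)
  fix t
  show "hausdorff_measure t (digit_cube (real ` {..<M}) r :: (real ^ 'd) set) = 0" if "s < t"
  proof (rule hausdorff_measure_box_covered[OF box_covered_digit_cube])
    have "real (card (real ` {..<M}) ^ CARD('d)) * r powr t = real M powr (?d + - (?d / s) * t)"
      using M unfolding card r_def powr_add powr_powr by (simp add: powr_realpow)
    also have "\<dots> < 1"
      using M s that by (intro powr_less_one) (simp_all add: field_simps)
    finally show "real (card (real ` {..<M}) ^ CARD('d)) * r powr t < 1" .
  qed (use r \<open>r < 1\<close> s that digit_system_nat in simp_all)
  show "hausdorff_measure t (digit_cube (real ` {..<M}) r :: (real ^ 'd) set) \<noteq> 0" if "0 \<le> t" "t \<le> s"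
  proof (rule hausdorff_measure_digit_cube_nonzero[OF r M gap, of "s / ?d"])
    show "r powr (s / ?d) = 1 / real M"
    proof -
      have "- (?d / s) * (s / ?d) = - 1" using s by simp
      then show ?thesis using M unfolding r_def powr_powr by (simp add: powr_minus_divide)
    qed
  qed (use that s in simp_all)
qed (use s in simp)

section \<open>Minors and linear independence\<close>

text \<open>Replaces kernel vectors of fixed length by functions on the naturals, of which only the
  first \<open>n\<close> values count.\<close>

lemma det_mat_eq_0_iff:
  fixes f :: "nat \<times> nat \<Rightarrow> real"
  shows "Determinant.det (Matrix.mat n n f) = 0 \<longleftrightarrow>
    (\<exists>v. (\<exists>j<n. v j \<noteq> 0) \<and> (\<forall>i<n. (\<Sum>j<n. f (i, j) * v j) = 0))"
proof -
  let ?A = "Matrix.mat n n f"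
  have mult: "?A *\<^sub>v Matrix.vec n v = 0\<^sub>v n \<longleftrightarrow> (\<forall>i<n. (\<Sum>j<n. f (i, j) * v j) = 0)" for v :: "nat \<Rightarrow> real"
    by (auto simp: Matrix.vec_eq_iff scalar_prod_def atLeast0LessThan)
  have "Determinant.det ?A = 0 \<longleftrightarrow> (\<exists>v. v \<in> carrier_vec n \<and> v \<noteq> 0\<^sub>v n \<and> ?A *\<^sub>v v = 0\<^sub>v n)"
    by (rule det_0_iff_vec_prod_zero_field) simp
  also have "\<dots> \<longleftrightarrow> (\<exists>v. Matrix.vec n v \<noteq> 0\<^sub>v n \<and> ?A *\<^sub>v Matrix.vec n v = 0\<^sub>v n)"
  proof safe
    fix v :: "real Matrix.vec" assume v: "v \<in> carrier_vec n" "v \<noteq> 0\<^sub>v n" "?A *\<^sub>v v = 0\<^sub>v n"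
    have "Matrix.vec n (vec_index v) = v" using v(1) by (auto simp: Matrix.vec_eq_iff)
    then show "\<exists>v. Matrix.vec n v \<noteq> 0\<^sub>v n \<and> ?A *\<^sub>v Matrix.vec n v = 0\<^sub>v n"
      using v by (intro exI[of _ "vec_index v"]) simp
  qed (use vec_carrier in blast)
  also have "\<dots> \<longleftrightarrow> (\<exists>v. (\<exists>j<n. v j \<noteq> 0) \<and> (\<forall>i<n. (\<Sum>j<n. f (i, j) * v j) = 0))"
    unfolding mult by (auto simp: Matrix.vec_eq_iff)
  finally show ?thesis .
qed

text \<open>Singularity is invariant under permuting rows and columns, so the enumerations by
  \<open>from_nat_into\<close> disappear.\<close>

lemma minor_eq_0_iff:
  fixes M :: "real ^ 'n::finite ^ 'm::finite"
  assumes "card C = card H"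
  shows "minor M H C = 0 \<longleftrightarrow>
    (\<exists>v. (\<exists>j\<in>C. v j \<noteq> 0) \<and> (\<forall>e\<in>H. (\<Sum>j\<in>C. M $ e $ j * v j) = 0))"
proof -
  define n where "n = card H"
  define h where "h = from_nat_into H"
  define g where "g = from_nat_into C"
  have h: "bij_betw h {..<n} H" and g: "bij_betw g {..<n} C"
    using bij_betw_from_nat_into_finite[of H] bij_betw_from_nat_into_finite[of C] assms
    by (simp_all add: h_def g_def n_def)
  have reindex: "(\<Sum>j\<in>C. w j) = (\<Sum>j<n. w (g j))" for w :: "'n \<Rightarrow> real"
    using sum.reindex_bij_betw[OF g] by metis
  have "minor M H C = 0 \<longleftrightarrow>
      (\<exists>v. (\<exists>j<n. v j \<noteq> 0) \<and> (\<forall>i<n. (\<Sum>j<n. M $ h i $ g j * v j) = 0))"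
    unfolding minor_def assms n_def[symmetric] h_def[symmetric] g_def[symmetric] det_mat_eq_0_iff case_prod_conv ..
  also have "\<dots> \<longleftrightarrow> (\<exists>v. (\<exists>j<n. v (g j) \<noteq> 0) \<and> (\<forall>i<n. (\<Sum>j<n. M $ h i $ g j * v (g j)) = 0))"
  proof
    assume "\<exists>v. (\<exists>j<n. v j \<noteq> 0) \<and> (\<forall>i<n. (\<Sum>j<n. M $ h i $ g j * v j) = 0)"
    then obtain v j where v: "\<forall>i<n. (\<Sum>j<n. M $ h i $ g j * v j) = 0" "j < n" "v j \<noteq> 0" by blast
    let ?v = "\<lambda>x. v (the_inv_into {..<n} g x)"
    have "?v (g j) = v j" if "j < n" for j
      using that g by (simp add: bij_betw_def the_inv_into_f_f)
    then show "\<exists>v. (\<exists>j<n. v (g j) \<noteq> 0) \<and> (\<forall>i<n. (\<Sum>j<n. M $ h i $ g j * v (g j)) = 0)"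
      using v by (intro exI[of _ ?v]) auto
  next
    assume "\<exists>v. (\<exists>j<n. v (g j) \<noteq> 0) \<and> (\<forall>i<n. (\<Sum>j<n. M $ h i $ g j * v (g j)) = 0)"
    then obtain v where "(\<exists>j<n. v (g j) \<noteq> 0) \<and> (\<forall>i<n. (\<Sum>j<n. M $ h i $ g j * v (g j)) = 0)" ..
    then show "\<exists>v. (\<exists>j<n. v j \<noteq> 0) \<and> (\<forall>i<n. (\<Sum>j<n. M $ h i $ g j * v j) = 0)"
      by (intro exI[of _ "\<lambda>j. v (g j)"])
  qed
  also have "\<dots> \<longleftrightarrow> (\<exists>v. (\<exists>j\<in>C. v j \<noteq> 0) \<and> (\<forall>e\<in>H. (\<Sum>j\<in>C. M $ e $ j * v j) = 0))"
    unfolding reindex using h g by (auto simp: bij_betw_def)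
  finally show ?thesis .
qed

lemma minor_transpose:
  fixes M :: "real ^ 'n::finite ^ 'm::finite"
  assumes "card C = card H"
  shows "minor (transpose M) C H = minor M H C"
proof -
  let ?A = "Matrix.mat (card H) (card C) (\<lambda>(a, b). M $ from_nat_into H a $ from_nat_into C b)"
  have "minor (transpose M) C H = Determinant.det (transpose_mat ?A)"
    unfolding minor_def by (rule arg_cong[of _ _ Determinant.det]) (auto simp: transpose_def)
  also have "\<dots> = minor M H C"
    unfolding minor_def using assms by (intro Determinant.det_transpose[of _ "card H"]) auto
  finally show ?thesis .
qed

lemma independent_family_iff:
  fixes f :: "'a \<Rightarrow> 'b::real_vector"
  assumes "finite H"
  shows "inj_on f H \<and> independent (f ` H) \<longleftrightarrow>
    (\<forall>c. (\<Sum>e\<in>H. c e *\<^sub>R f e) = 0 \<longrightarrow> (\<forall>e\<in>H. c e = 0))" (is "?L \<longleftrightarrow> ?R")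
proof
  assume L: ?L
  show ?R
  proof (intro allI impI ballI)
    fix c e assume c: "(\<Sum>e\<in>H. c e *\<^sub>R f e) = 0" and e: "e \<in> H"
    let ?u = "\<lambda>y. c (the_inv_into H f y)"
    have u: "?u (f e) = c e" if "e \<in> H" for e
      using that L by (simp add: the_inv_into_f_f)
    have "(\<Sum>y\<in>f ` H. ?u y *\<^sub>R y) = (\<Sum>e\<in>H. c e *\<^sub>R f e)"
      using L u by (simp add: sum.reindex)
    then have "?u (f e) = 0"
      using L c e assms by (intro independentD[of "f ` H" "f ` H" ?u]) auto
    then show "c e = 0" using u e by simp
  qed
next
  assume R: ?R
  have inj: "inj_on f H"
  proof (rule inj_onI, rule ccontr)
    fix a b assume ab: "a \<in> H" "b \<in> H" "f a = f b" "a \<noteq> b"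
    let ?c = "\<lambda>e. if e = a then 1 else if e = b then - 1 else (0::real)"
    have "(\<Sum>e\<in>H. ?c e *\<^sub>R f e) = (\<Sum>e\<in>{a, b}. ?c e *\<^sub>R f e)"
      using ab assms by (intro sum.mono_neutral_right) auto
    also have "\<dots> = 0" using ab by simp
    finally show False using R ab by force
  qed
  moreover have "independent (f ` H)"
  proof (rule independent_if_scalars_zero)
    fix u y assume "(\<Sum>y\<in>f ` H. u y *\<^sub>R y) = 0" "y \<in> f ` H"
    then show "u y = 0" using R inj by (auto simp: sum.reindex)
  qed (use assms in simp)
  ultimately show ?L by blast
qed

text \<open>A linear relation among the rows in \<open>H\<close> makes every minor on these rows
  vanish. Conversely, equality of row rank and column rank supplies \<open>card H\<close>
  independent columns of the submatrix, and the minor on them is nonzero.\<close>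

lemma exists_minor_iff:
  fixes M :: "real ^ 'n::finite ^ 'm::finite"
  shows "(\<exists>C. card C = card H \<and> minor M H C \<noteq> 0) \<longleftrightarrow>
    inj_on (\<lambda>e. row e M) H \<and> independent ((\<lambda>e. row e M) ` H)" (is "?L \<longleftrightarrow> ?R")
proof
  assume ?L
  then obtain C where C: "card C = card H" and nz: "minor M H C \<noteq> 0" by blast
  have "c e = 0" if c: "(\<Sum>e\<in>H. c e *\<^sub>R row e M) = 0" and e: "e \<in> H" for c e
  proof (rule ccontr)
    assume "c e \<noteq> 0"
    moreover have "(\<Sum>e\<in>H. transpose M $ j $ e * c e) = 0" for j
      using arg_cong[OF c, of "\<lambda>x. x $ j"] by (simp add: row_def transpose_def mult.commute)
    ultimately have "minor (transpose M) C H = 0"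
      using e C by (subst minor_eq_0_iff) auto
    then show False using nz C by (simp add: minor_transpose)
  qed
  then show ?R by (subst independent_family_iff) auto
next
  assume R: ?R
  \<comment> \<open>The submatrix is represented without changing the index type: rows outside
    \<open>H\<close> become 0, which affects neither the row span nor relations among
    columns.\<close>
  define N :: "real ^ 'n ^ 'm" where "N = (\<chi> e. if e \<in> H then row e M else 0)"
  have N: "N $ e $ j = (if e \<in> H then M $ e $ j else 0)" for e j
    by (simp add: N_def row_def)
  have rowN: "row e N = (if e \<in> H then row e M else 0)" for e
    by (simp add: row_def N_def)
  have "span (rows N) = span ((\<lambda>e. row e M) ` H)"
  proof (rule subset_antisym; rule span_minimal)
    show "rows N \<subseteq> span ((\<lambda>e. row e M) ` H)"
      by (auto simp: rows_def rowN intro: span_base span_zero)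
    show "(\<lambda>e. row e M) ` H \<subseteq> span (rows N)"
    proof (rule image_subsetI)
      fix e assume "e \<in> H"
      then have "row e M = row e N" by (simp add: rowN)
      then show "row e M \<in> span (rows N)" by (auto simp: rows_def intro: span_base)
    qed
  qed auto
  then have "rank N = card H"
    using R unfolding row_rank_def
    by (metis card_image dim_eq_card_independent dim_span)
  then have dimc: "dim (columns N) = card H" by (simp add: column_rank_def)
  obtain B where B: "B \<subseteq> columns N" "independent B" "card B = card H"
    using basis_exists[of "columns N"] dimc by metis
  then have "B \<subseteq> (\<lambda>j. column j N) ` UNIV" by (auto simp: columns_def)
  then obtain C where C: "inj_on (\<lambda>j. column j N) C" "B = (\<lambda>j. column j N) ` C"
    by (metis subset_image_inj)
  then have card: "card C = card H" using B by (simp add: card_image)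
  have "minor M H C \<noteq> 0"
  proof
    assume "minor M H C = 0"
    then obtain v j where j: "j \<in> C" "v j \<noteq> 0" and v: "\<And>e. e \<in> H \<Longrightarrow> (\<Sum>j\<in>C. M $ e $ j * v j) = 0"
      using card by (subst (asm) minor_eq_0_iff) auto
    have "(\<Sum>j\<in>C. v j * N $ e $ j) = 0" for e
      using v[of e] by (cases "e \<in> H") (simp_all add: N mult.commute)
    then have "(\<Sum>j\<in>C. v j *\<^sub>R column j N) = 0"
      by (simp add: vec_eq_iff column_def)
    then show False using B C j independent_family_iff[of C "\<lambda>j. column j N"] by auto
  qed
  then show ?L using card by blast
qed

lemma P_edges_nonzero_iff:
  fixes x :: "real ^ ('v::{finite,linorder} \<times> 'd::finite)"
  assumes "H \<subseteq> complete_graph"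
  shows "P_edges H x \<noteq> 0 \<longleftrightarrow> independent_at H x"
proof -
  have "P_edges H x = 0 \<longleftrightarrow> (\<forall>C. card C = card H \<longrightarrow> minor (DF complete_graph x) H C = 0)"
    unfolding P_edges_def by (subst sum_nonneg_eq_0_iff) auto
  then show ?thesis
    unfolding independent_at_def using assms exists_minor_iff[of H "DF complete_graph x"] by auto
qed

section \<open>Generic tuples and infinitesimal rigidity\<close>

lemma point_component [simp]: "point x i $ c = x $ (i, c)"
  by (simp add: point_def)

lemma point_add: "point (x + y) i = point x i + point y i"
  and point_scaleR: "point (a *\<^sub>R x) i = a *\<^sub>R point x i"
  by (simp_all add: vec_eq_iff)

lemma bounded_linear_point: "bounded_linear (\<lambda>x. point x i)"
  by (intro linear_conv_bounded_linear[THEN iffD1] linearI point_add point_scaleR)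

text \<open>The derivative of the squared norm of the difference of two points; later arguments
  reach the Jacobian through this formula.\<close>

lemma DF_mult:
  fixes x h :: "real ^ ('v::{finite,linorder} \<times> 'd::finite)"
  shows "(DF G x *v h) $ e =
    (if e \<in> G then 2 * ((point x (fst e) - point x (snd e)) \<bullet> (point h (fst e) - point h (snd e))) else 0)"
proof -
  define L :: "real ^ ('v \<times> 'd) \<Rightarrow> real ^ ('v \<times> 'v)" where
    "L h = (\<chi> e. if e \<in> G then 2 * ((point x (fst e) - point x (snd e)) \<bullet> (point h (fst e) - point h (snd e))) else 0)" for h
  have "((\<lambda>x. sqdist_map G x \<bullet> b) has_derivative (\<lambda>h. L h \<bullet> b)) (at x)" if "b \<in> Basis" for b
  proof -
    obtain e where b: "b = axis e 1" using \<open>b \<in> Basis\<close> by (auto simp: Basis_vec_def)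
    note [derivative_intros] = bounded_linear.has_derivative[OF bounded_linear_point]
    show ?thesis
      unfolding b inner_axis sqdist_map_def L_def
      by (cases "e \<in> G") (auto simp: power2_norm_eq_inner inner_commute intro!: derivative_eq_intros)
  qed
  then have D: "(sqdist_map G has_derivative L) (at x)"
    using has_derivative_componentwise_within by blast
  then have "linear L" by (rule has_derivative_linear)
  moreover have "DF G x = matrix L"
    unfolding DF_def jacobian_def using frechet_derivative_at[OF D] by simp
  ultimately have "DF G x *v h = L h" by simp
  then show ?thesis by (simp add: L_def)
qed

lemma row_DF_inner:
  fixes x h :: "real ^ ('v::{finite,linorder} \<times> 'd::finite)"
  assumes "e \<in> complete_graph"
  shows "row e (DF complete_graph x) \<bullet> h =
    2 * ((point x (fst e) - point x (snd e)) \<bullet> (point h (fst e) - point h (snd e)))"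
  using DF_mult[of complete_graph x h e] assms
  by (simp add: matrix_vector_mul_component row_def)

lemma DF_entry:
  fixes x :: "real ^ ('v::{finite,linorder} \<times> 'd::finite)"
  assumes "e \<in> complete_graph"
  shows "DF complete_graph x $ e $ (v, c) =
    2 * (x $ (fst e, c) - x $ (snd e, c)) * (of_bool (fst e = v) - of_bool (snd e = v))"
proof -
  have pt: "point (axis (v, c) 1 :: real ^ ('v \<times> 'd)) w = of_bool (w = v) *\<^sub>R axis c 1" for w
    by (auto simp: vec_eq_iff axis_def)
  have "DF complete_graph x $ e $ (v, c) = row e (DF complete_graph x) \<bullet> axis (v, c) 1"
    by (simp add: inner_axis row_def)
  also have "\<dots> = 2 * (x $ (fst e, c) - x $ (snd e, c)) * (of_bool (fst e = v) - of_bool (snd e = v))"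
    unfolding row_DF_inner[OF assms] pt
    by (simp add: inner_diff_right inner_axis algebra_simps)
  finally show ?thesis .
qed

section \<open>Existence of generic tuples\<close>

text \<open>On the line through \<open>x\<close> and \<open>y\<close> both functions become nonzero
  polynomials in one variable, with finitely many roots, so some point of the line avoids all
  roots.\<close>

lemma real_polynomial_nonzero_mult:
  fixes p q :: "'a::euclidean_space \<Rightarrow> real"
  assumes "real_polynomial_function p" "real_polynomial_function q" "p x \<noteq> 0" "q y \<noteq> 0"
  shows "\<exists>z. p z * q z \<noteq> 0"
proof -
  define l where "l t = x + t *\<^sub>R (y - x)" for t
  have line: "finite {t. f (l t) = 0}" if f: "real_polynomial_function f" and nz: "f (l t0) \<noteq> 0" for f t0
  proof -
    have "polynomial_function l"
      unfolding l_def
      by (intro polynomial_function_add polynomial_function_const polynomial_function_bounded_linear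
          bounded_linear_scaleR_left)
    then have "real_polynomial_function (f \<circ> l)" using f by (rule real_polynomial_function_compose)
    then obtain a n where an: "f \<circ> l = (\<lambda>t. \<Sum>i\<le>n. a i * t ^ i)"
      using real_polynomial_function_imp_sum by blast
    then have eq: "f (l t) = (\<Sum>i\<le>n. a i * t ^ i)" for t by (metis comp_apply)
    have "\<exists>i\<le>n. a i \<noteq> 0"
    proof (rule ccontr)
      assume "\<not> ?thesis"
      then show False using nz eq[of t0] by simp
    qed
    then show ?thesis unfolding eq using polyfun_finite_roots by blast
  qed
  have "finite ({t. p (l t) = 0} \<union> {t. q (l t) = 0})"
    using line[OF assms(1), of 0] line[OF assms(2), of 1] assms(3,4) by (simp add: l_def)
  then obtain t where "t \<notin> {t. p (l t) = 0} \<union> {t. q (l t) = 0}"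
    using ex_new_if_finite infinite_UNIV_char_0 by blast
  then show ?thesis by auto
qed

lemma real_polynomial_nonzero_prod:
  fixes p :: "'i \<Rightarrow> 'a::euclidean_space \<Rightarrow> real"
  assumes "finite I" "\<And>i. i \<in> I \<Longrightarrow> real_polynomial_function (p i)" "\<And>i. i \<in> I \<Longrightarrow> \<exists>x. p i x \<noteq> 0"
  shows "\<exists>x. (\<Prod>i\<in>I. p i x) \<noteq> 0"
  using assms
proof (induction I rule: finite_induct)
  case (insert i I)
  then obtain x y where "p i x \<noteq> 0" "(\<Prod>i\<in>I. p i y) \<noteq> 0" by (metis insertCI)
  moreover have "real_polynomial_function (\<lambda>x. \<Prod>i\<in>I. p i x)"
    using real_polynomial_function_prod[of I "\<lambda>x i. p i x"] insert by blast
  ultimately have "\<exists>z. p i z * (\<Prod>i\<in>I. p i z) \<noteq> 0"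
    using insert.prems by (intro real_polynomial_nonzero_mult) auto
  then show ?case using insert.hyps by simp
qed auto

text \<open>The entries of the Jacobian are linear in the tuple, and the Leibniz formula makes the
  minors polynomial in the entries.\<close>

lemma real_polynomial_function_P_edges:
  assumes "H \<subseteq> complete_graph"
  shows "real_polynomial_function
    (P_edges H :: real ^ ('v::{finite,linorder} \<times> 'd::finite) \<Rightarrow> real)"
proof -
  have coord: "real_polynomial_function (\<lambda>x :: real ^ ('v \<times> 'd). x $ i)" for i
    by (rule real_polynomial_function.intros(1)) (rule bounded_linear_vec_nth)
  have "real_polynomial_function (\<lambda>x :: real ^ ('v \<times> 'd). DF complete_graph x $ e $ j)"
    if "e \<in> H" for e j
  proof (cases j)
    case (Pair v c)
    show ?thesis
      unfolding Pair DF_entry[OF subsetD[OF assms \<open>e \<in> H\<close>]]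
      by (intro real_polynomial_function.intros(4) real_polynomial_function_diff coord
          real_polynomial_function.intros(2))
  qed
  moreover have "from_nat_into H a \<in> H" if "a < card H" for a
    using that by (intro from_nat_into) auto
  ultimately have entry: "real_polynomial_function (\<lambda>x :: real ^ ('v \<times> 'd). DF complete_graph x $ from_nat_into H a $ j)"
    if "a < card H" for a j
    using that by blast
  have "real_polynomial_function (\<lambda>x :: real ^ ('v \<times> 'd). minor (DF complete_graph x) H C)"
    if "card C = card H" for C
    unfolding minor_def that
    by (subst Determinant.det_def'[of _ "card H"])
       (auto intro!: real_polynomial_function_sum real_polynomial_function_prod
          real_polynomial_function.intros(4) real_polynomial_function.intros(2) entry simp: finite_permutations)
  then show ?thesis
    unfolding P_edges_def[abs_def]
    by (intro real_polynomial_function_sum real_polynomial_function_power) auto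
qed

lemma independent_edgesD: "independent_edges T H \<Longrightarrow> H \<subseteq> complete_graph"
  by (auto simp: independent_edges_def independent_at_def)

lemma generic_imp_independent_at:
  fixes x :: "real ^ ('v::{finite,linorder} \<times> 'd::finite)"
  assumes "generic x" "independent_edges TYPE('d) H"
  shows "independent_at H x"
proof (cases "H = {}")
  case False
  then have "P_edges H x \<noteq> 0"
    using assms unfolding generic_def P_total_def by (subst (asm) prod_zero_iff) auto
  then show ?thesis using independent_edgesD[OF assms(2)] by (simp add: P_edges_nonzero_iff)
qed (simp add: independent_at_def independent_empty)

text \<open>Each factor of \<open>P_total\<close> is a polynomial with a nonzero value, by
  independence of the corresponding \<open>H\<close> at some tuple. Rigidity quantifies over generic
  tuples, so existence is what gives it content.\<close>

lemma generic_exists: "\<exists>x :: real ^ ('v::{finite,linorder} \<times> 'd::finite). generic x"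
  unfolding generic_def P_total_def
proof (rule real_polynomial_nonzero_prod)
  fix H :: "('v \<times> 'v) set" assume H: "H \<in> {H. H \<noteq> {} \<and> independent_edges TYPE('d) H}"
  then have K: "H \<subseteq> complete_graph" using independent_edgesD by blast
  show "real_polynomial_function (P_edges H :: real ^ ('v \<times> 'd) \<Rightarrow> real)"
    by (rule real_polynomial_function_P_edges[OF K])
  show "\<exists>x :: real ^ ('v \<times> 'd). P_edges H x \<noteq> 0"
    using H K by (simp add: P_edges_nonzero_iff independent_edges_def)
qed simp

section \<open>An independent graph with many edges\<close>

text \<open>The join of the complete graph on \<open>D\<close> with the edgeless graph on the other
  vertices, that is, the edgeless graph coned \<open>card D\<close> times.\<close>

definition cone_graph :: "'v set \<Rightarrow> ('v::{finite,linorder} \<times> 'v) set" where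
  "cone_graph D = {(i, j). i < j \<and> (i \<in> D \<or> j \<in> D)}"

lemma cone_graph_subset: "cone_graph D \<subseteq> complete_graph"
  by (auto simp: cone_graph_def complete_graph_def)

lemma card_ordered_pairs:
  fixes A :: "'a::linorder set"
  assumes "finite A"
  shows "real (card {(i, j). i \<in> A \<and> j \<in> A \<and> i < j}) = real (card A) * (real (card A) - 1) / 2"
proof -
  let ?T = "{(i, j). i \<in> A \<and> j \<in> A \<and> i < j}"
  have fin: "finite ?T" by (rule finite_subset[of _ "A \<times> A"]) (use assms in auto)
  have swap: "card (prod.swap ` ?T) = card ?T" by (rule card_image) (auto simp: inj_on_def)
  have diag: "card ((\<lambda>i. (i, i)) ` A) = card A" by (rule card_image) (auto simp: inj_on_def)
  have "A \<times> A \<subseteq> ?T \<union> prod.swap ` ?T \<union> (\<lambda>i. (i, i)) ` A"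
  proof
    fix e assume "e \<in> A \<times> A"
    then obtain i j where "e = (i, j)" "i \<in> A" "j \<in> A" by blast
    then show "e \<in> ?T \<union> prod.swap ` ?T \<union> (\<lambda>i. (i, i)) ` A"
      by (cases i j rule: linorder_cases) (auto simp: image_iff)
  qed
  then have eq: "A \<times> A = ?T \<union> prod.swap ` ?T \<union> (\<lambda>i. (i, i)) ` A" by auto
  have "card A * card A = card (A \<times> A)" by (simp add: card_cartesian_product)
  also have "\<dots> = card (?T \<union> prod.swap ` ?T \<union> (\<lambda>i. (i, i)) ` A)" by (rule arg_cong[OF eq])
  also have "\<dots> = card (?T \<union> prod.swap ` ?T) + card A"
    using fin assms by (subst card_Un_disjoint) (auto simp: diag)
  also have "card (?T \<union> prod.swap ` ?T) = card ?T + card ?T"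
    using fin by (subst card_Un_disjoint) (auto simp: swap)
  finally have "card A * card A = card ?T + card ?T + card A" .
  from arg_cong[OF this, of real] have "real (card A) * real (card A) = 2 * real (card ?T) + real (card A)"
    by simp
  then show ?thesis by (simp add: algebra_simps)
qed

text \<open>Counts all pairs and removes those avoiding \<open>D\<close>. For
  \<open>card D = d\<close> the result equals \<open>d * (k + 1) - (d + 1 choose 2)\<close>, the
  number of coordinates minus the dimension of the group of rigid motions.\<close>

lemma card_cone_graph:
  fixes D :: "'v::{finite,linorder} set"
  assumes "CARD('v) = k + 1"
  shows "real (card (cone_graph D)) = real (card D) * real k - real (card D choose 2)"
proof -
  let ?T = "\<lambda>A. {(i, j). i \<in> A \<and> j \<in> A \<and> i < (j :: 'v)}"
  have "?T UNIV = cone_graph D \<union> ?T (- D)" by (auto simp: cone_graph_def)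
  then have "card (?T UNIV) = card (cone_graph D \<union> ?T (- D))" by simp
  also have "\<dots> = card (cone_graph D) + card (?T (- D))"
    by (rule card_Un_disjoint) (auto simp: cone_graph_def)
  finally have G: "real (card (cone_graph D)) = real (card (?T UNIV)) - real (card (?T (- D)))"
    by linarith
  have "card D + card (- D) = k + 1"
    using assms card_Un_disjoint[of D "- D"] by simp
  then have "real (card (- D)) = real k + 1 - real (card D)" by linarith
  then have T1: "real (card (?T (- D))) = (real k + 1 - real (card D)) * (real k - real (card D)) / 2"
    using card_ordered_pairs[of "- D"] by simp
  have T2: "real (card (?T UNIV)) = (real k + 1) * real k / 2"
    using card_ordered_pairs[of "UNIV :: 'v set"] assms by simp
  have choose: "real (n choose 2) = real n * (real n - 1) / 2" for n
  proof (induction n)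
    case (Suc n)
    have "real (Suc n choose 2) = real n + real (n choose 2)"
      by (simp add: numeral_2_eq_2)
    then show ?case using Suc by (simp add: field_simps)
  qed simp
  show ?thesis
    unfolding G T1 T2 choose by (simp add: field_simps)
qed

text \<open>The witness places the vertices of \<open>range p\<close> at the unit vectors and all others at the origin:
  then coordinate \<open>c\<close> of the equilibrium condition at a vertex \<open>v\<close> involves only the edge from \<open>v\<close> to \<open>p c\<close>.\<close>

lemma independent_cone_graph:
  fixes p :: "'d::finite \<Rightarrow> 'v::{finite,linorder}"
  shows "independent_edges TYPE('d) (cone_graph (range p))"
proof -
  let ?G = "cone_graph (range p)"
  define x :: "real ^ ('v \<times> 'd)" where "x = (\<chi> i. of_bool (fst i = p (snd i)))"
  have "w e = 0" if w: "(\<Sum>e\<in>?G. w e *\<^sub>R row e (DF complete_graph x)) = 0" and e: "e \<in> ?G" for w e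
  proof -
    have lt: "fst e < snd e" using e by (auto simp: cone_graph_def)
    obtain c where c: "fst e = p c \<or> snd e = p c" using e by (force simp: cone_graph_def)
    \<comment> \<open>If both ends of \<open>e\<close> lie in \<open>range p\<close>, either may be
      taken as \<open>p c\<close>; \<open>v\<close> is the other end.\<close>
    define v where "v = (if fst e = p c then snd e else fst e)"
    have cv: "fst e = p c \<and> snd e = v \<or> fst e = v \<and> snd e = p c" and "v \<noteq> p c"
      using c lt by (auto simp: v_def)
    have entry: "DF complete_graph x $ e' $ (v, c) =
        2 * (of_bool (fst e' = p c) - of_bool (snd e' = p c)) * (of_bool (fst e' = v) - of_bool (snd e' = v))"
      if "e' \<in> ?G" for e'
      using that cone_graph_subset by (subst DF_entry) (auto simp: x_def)
    have "e' = e" if e': "e' \<in> ?G" and nz: "DF complete_graph x $ e' $ (v, c) \<noteq> 0" for e'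
    proof -
      have "fst e' < snd e'" using e' by (auto simp: cone_graph_def)
      moreover have "(fst e' = p c) \<noteq> (snd e' = p c)" "(fst e' = v) \<noteq> (snd e' = v)"
        using nz unfolding entry[OF e'] by (auto split: split_of_bool_asm)
      then have "fst e' = p c \<and> snd e' = v \<or> fst e' = v \<and> snd e' = p c"
        using \<open>v \<noteq> p c\<close> by metis
      ultimately have "fst e' = fst e \<and> snd e' = snd e" using cv lt by (metis less_asym)
      then show ?thesis by (simp add: prod_eq_iff)
    qed
    then have "DF complete_graph x $ e' $ (v, c) = 0" if "e' \<in> ?G - {e}" for e'
      using that by blast
    then have "(\<Sum>e\<in>?G. w e * DF complete_graph x $ e $ (v, c)) = w e * DF complete_graph x $ e $ (v, c)"
      using e by (subst sum.remove[of _ e]) auto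
    moreover have "(\<Sum>e\<in>?G. w e * DF complete_graph x $ e $ (v, c)) = 0"
      using arg_cong[OF w, of "\<lambda>y. y $ (v, c)"] by (simp add: row_def)
    moreover have "DF complete_graph x $ e $ (v, c) \<noteq> 0"
      unfolding entry[OF e] using cv \<open>v \<noteq> p c\<close> lt by (elim disjE) simp_all
    ultimately show "w e = 0" by simp
  qed
  then have "independent_at ?G x"
    using independent_family_iff[of ?G "\<lambda>e. row e (DF complete_graph x)"] cone_graph_subset
    unfolding independent_at_def by simp
  then show ?thesis by (auto simp: independent_edges_def)
qed

section \<open>Edge count and connectedness of rigid graphs\<close>

text \<open>Equality of kernels thereby becomes equality of row spans, since a subspace is recovered
  from its orthogonal complement.\<close>

lemma kernel_DF:
  fixes x :: "real ^ ('v::{finite,linorder} \<times> 'd::finite)"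
  assumes "G \<subseteq> complete_graph"
  shows "{v. DF G x *v v = 0} = (span ((\<lambda>e. row e (DF complete_graph x)) ` G))\<^sup>\<bottom>"
proof -
  have kernel: "DF G x *v v = 0 \<longleftrightarrow> (\<forall>e\<in>G. row e (DF complete_graph x) \<bullet> v = 0)" for v
  proof -
    have "DF G x *v v = 0 \<longleftrightarrow> (\<forall>e\<in>G. (DF G x *v v) $ e = 0)"
      by (auto simp: vec_eq_iff DF_mult)
    also have "\<dots> \<longleftrightarrow> (\<forall>e\<in>G. row e (DF complete_graph x) \<bullet> v = 0)"
      using assms by (intro ball_cong refl) (auto simp: DF_mult row_DF_inner subset_iff)
    finally show ?thesis .
  qed
  have orth: "(\<forall>y\<in>span S. orthogonal y v) \<longleftrightarrow> (\<forall>y\<in>S. y \<bullet> v = 0)"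
    for S :: "(real ^ ('v \<times> 'd)) set" and v
  proof
    assume "\<forall>y\<in>S. y \<bullet> v = 0"
    then have "\<And>y. y \<in> S \<Longrightarrow> orthogonal v y" by (simp add: orthogonal_def inner_commute)
    then show "\<forall>y\<in>span S. orthogonal y v"
      using orthogonal_to_span[of _ S v] by (simp add: orthogonal_commute)
  qed (simp add: orthogonal_def span_base)
  show ?thesis
    unfolding orthogonal_comp_def orth by (simp add: kernel)
qed

text \<open>At a generic tuple the rows of a rigid \<open>G\<close> span all rows of the complete
  graph, while the rows of \<open>H\<close> are independent there; the exchange lemma compares their
  numbers.\<close>

lemma card_independent_le_inf_rigid:
  fixes G H :: "('v::{finite,linorder} \<times> 'v) set"
  assumes "inf_rigid TYPE('d::finite) G" "G \<subseteq> complete_graph" "independent_edges TYPE('d) H"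
  shows "card H \<le> card G"
proof -
  obtain x :: "real ^ ('v \<times> 'd)" where x: "generic x" using generic_exists by blast
  let ?R = "\<lambda>e. row e (DF complete_graph x)"
  have "(span (?R ` G))\<^sup>\<bottom> = (span (?R ` complete_graph))\<^sup>\<bottom>"
    using assms x unfolding inf_rigid_def framework_inf_rigid_def by (simp add: kernel_DF)
  from arg_cong[OF this, of orthogonal_comp] have "span (?R ` G) = span (?R ` complete_graph)"
    by (simp add: orthogonal_comp_self)
  moreover have H: "independent_at H x" by (rule generic_imp_independent_at[OF x assms(3)])
  then have "?R ` H \<subseteq> span (?R ` complete_graph)"
    using span_superset[of "?R ` complete_graph"] unfolding independent_at_def by blast
  ultimately have "?R ` H \<subseteq> span (?R ` G)" by (simp only:)
  then have "card (?R ` H) \<le> card (?R ` G)"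
    using H independent_span_bound[of "?R ` G" "?R ` H"] unfolding independent_at_def by simp
  also have "\<dots> \<le> card G" by (simp add: card_image_le)
  finally show ?thesis using H by (simp add: independent_at_def card_image)
qed

text \<open>The complete graph is trivially rigid; a rigid graph with the fewest edges is
  minimal.\<close>

lemma minimally_inf_rigid_exists:
  "\<exists>G \<subseteq> (complete_graph :: ('v::{finite,linorder} \<times> 'v) set). minimally_inf_rigid TYPE('d::finite) G"
proof -
  let ?P = "\<lambda>G :: ('v \<times> 'v) set. G \<subseteq> complete_graph \<and> inf_rigid TYPE('d) G"
  have "?P complete_graph" by (simp add: inf_rigid_def framework_inf_rigid_def)
  from ex_has_least_nat[of ?P, OF this, of card]
  obtain G where "?P G \<and> (\<forall>G'. ?P G' \<longrightarrow> card G \<le> card G')" ..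
  then have G: "?P G" and least: "\<And>G'. ?P G' \<Longrightarrow> card G \<le> card G'" by simp_all
  have "\<not> inf_rigid TYPE('d) G'" if "G' \<subset> G" for G'
  proof
    assume "inf_rigid TYPE('d) G'"
    moreover have "G' \<subseteq> complete_graph" using that G by (auto dest: psubset_imp_subset)
    ultimately have "card G \<le> card G'" by (intro least) simp
    moreover have "card G' < card G" using that by (intro psubset_card_mono) auto
    ultimately show False by simp
  qed
  then have "minimally_inf_rigid TYPE('d) G" using G by (simp add: minimally_inf_rigid_def)
  then show ?thesis using G by (intro exI[of _ G]) simp
qed

text \<open>A single edge is independent, so its row is nonzero at every generic tuple, whereas
  coinciding endpoints would make it vanish.\<close>

lemma generic_points_distinct:
  fixes x :: "real ^ ('v::{finite,linorder} \<times> 'd::finite)"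
  assumes "generic x" "u \<noteq> v"
  shows "point x u \<noteq> point x v"
proof -
  have *: "point x u \<noteq> point x v" if "u < v" for u v
  proof -
    let ?y = "(\<chi> i. of_bool (fst i = u)) :: real ^ ('v \<times> 'd)"
    have K: "(u, v) \<in> complete_graph" using that by (simp add: complete_graph_def)
    have "row (u, v) (DF complete_graph ?y) $ (u, c) \<noteq> 0" for c
      using that by (simp add: row_def DF_entry[OF K])
    then have "row (u, v) (DF complete_graph ?y) \<noteq> 0" by auto
    then have "independent_at {(u, v)} ?y"
      using K by (simp add: independent_at_def independent_insert independent_empty)
    then have "independent_at {(u, v)} x"
      using generic_imp_independent_at[OF assms(1)] by (auto simp: independent_edges_def)
    then have "row (u, v) (DF complete_graph x) \<noteq> 0"
      by (auto simp: independent_at_def dependent_zero)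
    then show ?thesis
      using row_DF_inner[OF K, of x "row (u, v) (DF complete_graph x)"] by auto
  qed
  then show ?thesis using assms(2) by (metis linorder_neqE)
qed

text \<open>Translating a single component is a nontrivial infinitesimal motion.\<close>

lemma inf_rigid_imp_connected:
  fixes G :: "('v::{finite,linorder} \<times> 'v) set"
  assumes "inf_rigid TYPE('d::finite) G"
  shows "graph_connected G"
  unfolding graph_connected_def
proof (intro allI, rule ccontr)
  fix u v assume uv: "(u, v) \<notin> (G \<union> G\<inverse>)\<^sup>*"
  obtain x :: "real ^ ('v \<times> 'd)" where x: "generic x" using generic_exists by blast
  define S where "S = {w. (u, w) \<in> (G \<union> G\<inverse>)\<^sup>*}"
  have S: "u \<in> S" "v \<notin> S" using uv by (auto simp: S_def)
  then have "point x u - point x v \<noteq> 0" using generic_points_distinct[OF x, of u v] by auto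
  \<comment> \<open>The component \<open>S\<close> of \<open>u\<close> moves in the direction from
    \<open>v\<close> to \<open>u\<close>, so that the pair of \<open>u\<close> and \<open>v\<close>
    sees a nonzero derivative.\<close>
  define h :: "real ^ ('v \<times> 'd)" where "h = (\<chi> i. if fst i \<in> S then (point x u - point x v) $ snd i else 0)"
  have h: "point h w = (if w \<in> S then point x u - point x v else 0)" for w
    by (auto simp: vec_eq_iff h_def)
  have "a \<in> S \<longleftrightarrow> b \<in> S" if "(a, b) \<in> G" for a b
  proof -
    have "(a, b) \<in> G \<union> G\<inverse>" "(b, a) \<in> G \<union> G\<inverse>" using that by auto
    then show ?thesis unfolding S_def by (blast intro: rtrancl.rtrancl_into_rtrancl)
  qed
  then have "DF G x *v h = 0"
    by (auto simp: vec_eq_iff DF_mult h)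
  then have 0: "DF complete_graph x *v h = 0"
    using assms x unfolding inf_rigid_def framework_inf_rigid_def by blast
  obtain e where e: "e \<in> complete_graph" "e = (u, v) \<or> e = (v, u)"
    using S by (metis (no_types, lifting) complete_graph_def case_prodI linorder_neqE mem_Collect_eq)
  then have "(DF complete_graph x *v h) $ e = 2 * ((point x u - point x v) \<bullet> (point x u - point x v))"
    using S by (auto simp: DF_mult h inner_diff_left inner_diff_right)
  then show False using 0 \<open>point x u - point x v \<noteq> 0\<close> by simp
qed

section \<open>Choice of the parameters\<close>

lemma diff_digits_nat:
  assumes "a \<in> real ` {..<M}" "b \<in> real ` {..<M}"
  shows "a - b \<in> real_of_int ` {- int M<..<int M}"
proof -
  obtain i j where "i < M" "j < M" "a = real i" "b = real j" using assms by blast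
  then show ?thesis by (intro image_eqI[of _ _ "int i - int j"]) auto
qed

lemma card_diff_digits_le: "card (real_of_int ` {- int M<..<int M}) \<le> 2 * M"
proof -
  have "card (real_of_int ` {- int M<..<int M}) \<le> card {- int M<..<int M}"
    by (rule card_image_le) simp
  also have "\<dots> \<le> 2 * M" by simp
  finally show ?thesis .
qed

text \<open>With \<open>M\<close> digits and ratio \<open>M powr (- d / s)\<close>, the number of boxes for the difference vectors is
  \<open>M ^ (d * k)\<close> up to the factor \<open>2 ^ (d * k)\<close>, which is absorbed by taking \<open>M\<close> large.\<close>

lemma exists_base:
  fixes d k m :: nat and s :: real
  assumes "0 < s" "d > 0" "s * real k < real m"
  shows "\<exists>M\<ge>2. real ((2 * M) ^ (k * d)) * (real M powr (- (real d / s))) ^ m < 1"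
proof -
  \<comment> \<open>The exponent of \<open>M\<close> after collecting all powers; it is negative
    precisely because \<open>s * k < m\<close>.\<close>
  define \<beta> where "\<beta> = real (k * d) - real d / s * real m"
  have "\<beta> = real d * (real k - real m / s)" by (simp add: \<beta>_def field_simps)
  also have "\<dots> < 0" using assms by (intro mult_pos_neg) (simp_all add: field_simps)
  finally have "\<beta> < 0" .
  have "((\<lambda>M. real M powr \<beta>) \<longlongrightarrow> 0) sequentially"
    using \<open>\<beta> < 0\<close> by (rule tendsto_neg_powr) (rule filterlim_real_sequentially)
  then have "((\<lambda>M. 2 ^ (k * d) * real M powr \<beta>) \<longlongrightarrow> 2 ^ (k * d) * 0) sequentially"
    by (intro tendsto_intros)
  then have "\<forall>\<^sub>F M in sequentially. 2 ^ (k * d) * real M powr \<beta> < 1"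
    by (rule order_tendstoD) simp
  then have "\<forall>\<^sub>F M in sequentially. M \<ge> 2 \<and> 2 ^ (k * d) * real M powr \<beta> < 1"
    using eventually_ge_at_top[of "2 :: nat"] by eventually_elim simp
  then obtain M where M: "M \<ge> 2" "2 ^ (k * d) * real M powr \<beta> < 1"
    using eventually_happens by force
  have "real M ^ (k * d) * (real M powr (- (real d / s))) ^ m = real M powr \<beta>"
    using M(1) unfolding \<beta>_def
    by (simp add: powr_diff powr_realpow powr_power powr_minus field_simps flip: of_nat_mult)
  moreover have "real ((2 * M) ^ (k * d)) = 2 ^ (k * d) * real M ^ (k * d)"
    by (simp add: power_mult_distrib)
  ultimately have "real ((2 * M) ^ (k * d)) * (real M powr (- (real d / s))) ^ m = 2 ^ (k * d) * real M powr \<beta>"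
    by (simp only: mult.assoc)
  with M(2) have "real ((2 * M) ^ (k * d)) * (real M powr (- (real d / s))) ^ m < 1" by (simp only:)
  then show ?thesis using M(1) by blast
qed

section \<open>One fractal for both counterexamples\<close>

theorem theorem2p25:
  fixes d k :: nat and s :: real
  assumes "CARD('d::finite) = d" and "CARD('v::{finite,linorder}) = k + 1"
    and "d \<ge> 2" and "k > d"
    and "0 < s" and "s < real d"
    and "s < real d - real (d choose 2) / real k"
  shows
    "(\<exists>(G :: ('v \<times> 'v) set) (E :: (real ^ 'd) set).
        G \<subseteq> complete_graph \<and> graph_connected G \<and> minimally_inf_rigid TYPE('d) G \<and>
        compact E \<and> hausdorff_dim E = ereal s \<and>
        edge_coords G ` distance_set G (tuples_in E) \<in> null_sets (lebesgue_edges G)) \<and>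
     (\<exists>(G :: ('v \<times> 'v) set) (H :: ('v \<times> 'v) set) (E :: (real ^ 'd) set).
        G \<subseteq> complete_graph \<and> no_isolated_vertices G \<and> maximally_independent TYPE('d) G H \<and>
        compact E \<and> hausdorff_dim E = ereal s \<and>
        \<not> (hausdorff_dim (distance_set G (tuples_in E)) = ereal (real (card H)) \<and>
           hausdorff_measure (real (card H)) (distance_set G (tuples_in E)) > 0))"
proof -
  \<comment> \<open>Selects \<open>d\<close> of the \<open>k + 1\<close> vertices as the apices of
    the cone graph, labelled by the coordinate directions.\<close>
  obtain p :: "'d \<Rightarrow> 'v" where p: "inj p"
    using card_le_inj[of "UNIV :: 'd set" "UNIV :: 'v set"] assms(1,2,4) by auto
  define G0 :: "('v \<times> 'v) set" where "G0 = cone_graph (range p)"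
  define m where "m = card G0"
  have "card (range p) = d" using p assms(1) by (simp add: card_image)
  then have "real m = real d * real k - real (d choose 2)"
    using card_cone_graph[OF assms(2), of "range p"] by (simp add: m_def G0_def)
  also have "\<dots> = (real d - real (d choose 2) / real k) * real k"
    using assms(3,4) by (simp add: left_diff_distrib)
  finally have "s * real k < real m"
    using assms(3,4,7) by simp
  then obtain M where M: "M \<ge> 2" "real ((2 * M) ^ (k * d)) * (real M powr (- (real d / s))) ^ m < 1"
    using exists_base[of s d k m] assms(3,5) by auto
  define r where "r = real M powr (- (real d / s))"
  have "0 < r" using M(1) by (simp add: r_def)
  have "r < 1" using M(1) assms(3,5) unfolding r_def by (intro powr_less_one) simp_all
  define A where "A = real ` {..<M}"
  define A' where "A' = real_of_int ` {- int M<..<int M}"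
  have A: "digit_system A r" unfolding A_def using \<open>0 < r\<close> \<open>r < 1\<close> by (rule digit_system_nat)
  have A': "digit_system A' r" using \<open>0 < r\<close> \<open>r < 1\<close> unfolding A'_def by unfold_locales auto
  define E :: "(real ^ 'd) set" where "E = digit_cube A r"
  have "compact E" unfolding E_def by (rule compact_digit_cube[OF A])
  have dim: "hausdorff_dim E = ereal s"
    unfolding E_def A_def r_def using hausdorff_dim_digit_cube[where 'd='d, OF M(1) assms(5)] assms(1,6) by simp
  have cover: "box_covered (card A' ^ (k * d)) r (distance_set G (tuples_in E))" for G :: "('v \<times> 'v) set"
    unfolding E_def assms(1)[symmetric]
    using diff_digits_nat by (intro box_covered_distance_set A A' assms(2)) (simp add: A_def A'_def)
  \<comment> \<open>Stated for all \<open>n >= m\<close>: the cone graph has exactly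
    \<open>m\<close> edges, but for the rigid graph only the lower bound \<open>m\<close> on the
    edge count is available.\<close>
  have small: "real (card A' ^ (k * d)) * r ^ n < 1" if "m \<le> n" for n
  proof -
    have "card A' ^ (k * d) \<le> (2 * M) ^ (k * d)"
      unfolding A'_def by (intro power_mono card_diff_digits_le) simp
    then have "real (card A' ^ (k * d)) \<le> real ((2 * M) ^ (k * d))" by (simp only: of_nat_le_iff)
    moreover have "r ^ n \<le> r ^ m" using that \<open>0 < r\<close> \<open>r < 1\<close> by (intro power_decreasing) simp_all
    ultimately have "real (card A' ^ (k * d)) * r ^ n \<le> real ((2 * M) ^ (k * d)) * r ^ m"
      using \<open>0 < r\<close> by (intro mult_mono) simp_all
    then show ?thesis using M(2) by (simp add: r_def)
  qed
  have indep: "independent_edges TYPE('d) G0" unfolding G0_def by (rule independent_cone_graph)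
  obtain G :: "('v \<times> 'v) set" where G: "G \<subseteq> complete_graph" "minimally_inf_rigid TYPE('d) G"
    using minimally_inf_rigid_exists by blast
  then have rigid: "inf_rigid TYPE('d) G" by (simp add: minimally_inf_rigid_def)
  have "m \<le> card G" unfolding m_def by (rule card_independent_le_inf_rigid[OF rigid G(1) indep])
  then have "edge_coords G ` distance_set G (tuples_in E) \<in> null_sets (lebesgue_edges G)"
    using small \<open>0 < r\<close> by (intro null_edge_coords_box_covered[OF cover])
  moreover have "graph_connected G" by (rule inf_rigid_imp_connected[OF rigid])
  \<comment> \<open>Since \<open>d >= 2\<close>, every vertex has a neighbour among the apices, even
    if it is an apex itself.\<close>
  moreover have "no_isolated_vertices G0"
    unfolding no_isolated_vertices_def
  proof
    fix v
    obtain c :: 'd where "p c \<noteq> v"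
    proof -
      have "card (range p) > card {v}" using \<open>card (range p) = d\<close> assms(3) by simp
      then have "\<not> range p \<subseteq> {v}" using card_mono[of "{v}" "range p"] by auto
      then show thesis using that by blast
    qed
    then show "\<exists>w. (v, w) \<in> G0 \<or> (w, v) \<in> G0"
      by (intro exI[of _ "p c"]) (auto simp: G0_def cone_graph_def)
  qed
  moreover have "G0 \<subseteq> complete_graph" unfolding G0_def by (rule cone_graph_subset)
  moreover have "maximally_independent TYPE('d) G0 G0" using indep by (auto simp: maximally_independent_def)
  \<comment> \<open>For (b) both the graph and its maximally independent subset are
    \<open>G0\<close>, so the vanishing of this measure refutes the second half of the
    conjunction.\<close>
  moreover have "hausdorff_measure (real (card G0)) (distance_set G0 (tuples_in E)) = 0"
  proof (rule hausdorff_measure_box_covered[OF cover \<open>0 < r\<close> \<open>r < 1\<close>])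
    have "0 < real m" using \<open>s * real k < real m\<close> assms(5) by (smt (verit) mult_nonneg_nonneg of_nat_0_le_iff)
    then show "0 < real (card G0)" by (simp add: m_def)
    show "real (card A' ^ (k * d)) * r powr real (card G0) < 1"
      using small[of m] \<open>0 < r\<close> by (simp add: m_def powr_realpow)
  qed
  ultimately show ?thesis using G \<open>compact E\<close> dim by (metis less_irrefl)
qed

end
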